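(* Let $\nu>0$, $\alpha=2$, $N_k=\lambda^k$ for some $\lambda>1$, and let $\sigma>0$ satisfy $\lambda^\sigma\ge2$. Then there exists a non-negative, nontrivial solution $X=(X_k)_{k\ge1}$ of $$X_k'=-\nu N_k^2X_k+N_k^\alpha X_{k+1}^2-N_{k-1}^\alpha X_{k-1}X_k,\qquad k=1,2,\dots,\qquad X_0=0,$$ such that $$X\in\bigcap_{s<-\sigma}C([0,\infty);H^s)\cap\bigcap_{r\in\mathbb R}C((0,\infty);H^r),\qquad X(0)=0,$$ and $$\lim_{t\to0+}\|X(t)\|_{\ell^2}=\infty.$$ More precisely, there exist constants $c,t_0>0$ such that $$\|X(t)\|_{\ell^2}\ge c\left(1+\log\frac{t_0}{t}\right)^{1/3},\qquad 0<t<t_0.$$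
   Context: For a real sequence $X=(X_k)_{k\ge1}$ and $s\in\mathbb R$, $\|X\|_{H^s}^2:=\sum_{k\ge1}N_k^{2s}X_k^2$, $H^s$ is the space of sequences with finite norm, and $H^0=\ell^2$. Convention $N_0=1$ (immaterial, since $X_0=0$). Solutions are understood componentwise: each $X_k$ is a continuous function of time that satisfies the $k$-th differential equation. Non-negative means $X_k(t)\ge0$ for all $k$ and $t$. *)

theory Defs
  imports Complex_Main
begin

text \<open>
  A sequence \<open>(x_k)\<close>, \<open>k \<ge> 1\<close>, is a function \<open>nat \<Rightarrow> real\<close>. The slot \<open>k = 0\<close> does not enter the
  norms below (all series run over \<open>Suc k\<close>); in the system it carries the boundary value \<open>X_0 = 0\<close>.
\<close>

definition freq :: "real \<Rightarrow> nat \<Rightarrow> real" where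
  "freq lam k = lam ^ k"

definition Hs_space :: "real \<Rightarrow> real \<Rightarrow> (nat \<Rightarrow> real) set" where
  "Hs_space lam s =
     {x. summable (\<lambda>k. freq lam (Suc k) powr (2 * s) * (x (Suc k))\<^sup>2)}"

text \<open>Meaningful only on \<^const>\<open>Hs_space\<close>, since \<^const>\<open>suminf\<close> is unspecified on divergent series.\<close>

definition Hs_norm :: "real \<Rightarrow> real \<Rightarrow> (nat \<Rightarrow> real) \<Rightarrow> real" where
  "Hs_norm lam s x = sqrt (\<Sum>k. freq lam (Suc k) powr (2 * s) * (x (Suc k))\<^sup>2)"

definition l2_norm :: "(nat \<Rightarrow> real) \<Rightarrow> real" where
  "l2_norm x = sqrt (\<Sum>k. (x (Suc k))\<^sup>2)"

lemma Hs_norm_0: "lam > 0 \<Longrightarrow> Hs_norm lam 0 x = l2_norm x"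
  by (simp add: Hs_norm_def l2_norm_def freq_def)

lemma Hs_space_0: "lam > 0 \<Longrightarrow> Hs_space lam 0 = {x. summable (\<lambda>k. (x (Suc k))\<^sup>2)}"
  by (simp add: Hs_space_def freq_def)

text \<open>\<open>X \<in> C(I; H^s)\<close>, for a curve \<open>X\<close> of sequences.\<close>

definition Hs_continuous_on ::
    "real \<Rightarrow> real \<Rightarrow> real set \<Rightarrow> (real \<Rightarrow> nat \<Rightarrow> real) \<Rightarrow> bool" where
  "Hs_continuous_on lam s I X \<longleftrightarrow>
     (\<forall>t\<in>I. X t \<in> Hs_space lam s) \<and>
     (\<forall>t\<in>I. ((\<lambda>u. Hs_norm lam s (\<lambda>k. X u k - X t k)) \<longlongrightarrow> 0) (at t within I))"

text \<open>
  Componentwise solutions on \<open>[0, \<infinity>)\<close>; the derivative at \<open>t = 0\<close> is one-sided.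
\<close>

definition dyadic_solution ::
    "real \<Rightarrow> real \<Rightarrow> real \<Rightarrow> (real \<Rightarrow> nat \<Rightarrow> real) \<Rightarrow> bool" where
  "dyadic_solution \<nu> \<alpha> lam X \<longleftrightarrow>
     (\<forall>t\<ge>0. X t 0 = 0) \<and>
     (\<forall>k\<ge>1. continuous_on {0..} (\<lambda>t. X t k)) \<and>
     (\<forall>k\<ge>1. \<forall>t\<ge>0.
        ((\<lambda>u. X u k) has_real_derivative
           (- \<nu> * (freq lam k)\<^sup>2 * X t k
            + freq lam k powr \<alpha> * (X t (k + 1))\<^sup>2
            - freq lam (k - 1) powr \<alpha> * X t (k - 1) * X t k)) (at t within {0..}))"

end

theory Submission
  imports Defs "HOL-Analysis.Analysis" "HOL-Real_Asymp.Real_Asymp"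
    "HOL-Probability.Discrete_Topology" "HOL-Complex_Analysis.Great_Picard"
begin

text \<open>
  Energy moves from high modes to low ones. Truncate the system to the modes up to \<open>n\<close>, start with
  all the energy in mode \<open>n\<close>, and choose the initial amplitude so that the maximum of \<open>X_1\<close> over time
  is exactly 1. If the modes up to \<open>k\<close> never exceed \<open>M\<close>, then mode \<open>k + 1\<close> never exceeds \<open>2 M + \<nu> q\<close>,
  since a larger value would push mode \<open>k\<close> above \<open>M\<close>; hence \<open>X_k \<le> (1 + \<nu> q) 2^k\<close> uniformly
  in \<open>n\<close>, which is where \<open>\<lambda>^\<sigma> \<ge> 2\<close> enters. Dissipation of the tail energies turns this
  into a bound \<open>X_k(t)^2 \<le> C exp (- \<nu> q^k t)\<close> for \<open>t\<close> bounded away from 0, again uniformly in \<open>n\<close>.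
  A subsequence therefore converges to a solution starting from 0, which is nontrivial because \<open>X_1\<close>
  attains 1.

  At small times the first \<open>K ~ log (1/t)\<close> modes are still almost empty, so an energy of order 1 must
  later pass through each of these shells. With \<open>E\<close> the total energy at time \<open>t\<close>, passing from shell
  \<open>k + 1\<close> to shell \<open>k\<close> dissipates at least a multiple of \<open>E^(-1/2)\<close> in mode \<open>k + 1\<close>. Summing over
  the \<open>K\<close> shells gives \<open>E^(3/2) \<ge> c K\<close>.
\<close>

section \<open>Global flows of Lipschitz fields\<close>

lemma integral_has_vector_derivative_half_line:
  fixes h :: "real \<Rightarrow> 'a::banach"
  assumes "continuous_on {0..} h" and "t \<ge> 0"
  shows "((\<lambda>u. integral {0..u} h) has_vector_derivative h t) (at t within {0..})"
proof -
  have "((\<lambda>u. integral {0..u} h) has_vector_derivative h t) (at t within {0..t + 1})"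
    by (rule integral_has_vector_derivative)
       (use assms in \<open>auto intro: continuous_on_subset\<close>)
  moreover have "at t within {0..t + 1} = at t within {0..}"
    by (rule at_within_nhd[of t "{..<t + 1}"]) (use assms in auto)
  ultimately show ?thesis by simp
qed

text \<open>
  With the unknown rescaled by \<open>exp (- 2 L t)\<close>, the integral operator is a contraction with factor
  1/2 on all of the half line, so there is no gluing of local solutions.
\<close>

lemma lipschitz_flow_exists:
  fixes f :: "'a::banach \<Rightarrow> 'a"
  assumes L: "L > 0" and lip: "\<And>x y. norm (f x - f y) \<le> L * norm (x - y)" and f0: "f 0 = 0"
  obtains \<phi> :: "'a \<Rightarrow> real \<Rightarrow> 'a"
  where "\<And>x. \<phi> x 0 = x"
    and "\<And>x t. t \<ge> 0 \<Longrightarrow> (\<phi> x has_vector_derivative f (\<phi> x t)) (at t within {0..})"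
    and "\<And>x y t. t \<ge> 0 \<Longrightarrow> norm (\<phi> x t - \<phi> y t) \<le> 2 * exp (2 * L * t) * norm (x - y)"
proof -
  have contf: "continuous_on UNIV f"
  proof (rule continuous_onI)
    fix x e assume "e > (0::real)"
    then show "\<exists>d>0. \<forall>x'\<in>UNIV. dist x' x < d \<longrightarrow> dist (f x') (f x) \<le> e"
      using lip L by (intro exI[of _ "e / L"])
        (auto simp: dist_norm field_simps intro: order_trans[OF lip])
  qed
  \<comment> \<open>\<open>y\<close> stands for the solution multiplied by
    \<open>exp (- 2 * L * r)\<close>; \<open>I y\<close> is the field along the curve without this
    factor.\<close>
  define I where "I y r = f (exp (2 * L * r) *\<^sub>R apply_bcontfun y r)" for y :: "real \<Rightarrow>\<^sub>C 'a" and r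
  have contI: "continuous_on S (I y)" for y S
    unfolding I_def
    by (intro continuous_on_compose2[OF contf] continuous_intros) auto
  have contJ: "continuous_on {0..} (\<lambda>u. integral {0..u} (I y))" for y
    using integral_has_vector_derivative_half_line[OF contI]
    unfolding continuous_on_eq_continuous_within
    by (metis atLeast_iff has_vector_derivative_continuous)
  \<comment> \<open>The factor \<open>L * exp (2 * L * r)\<close> integrates to
    \<open>(exp (2 * L * t) - 1) / 2\<close>: the doubled rate in the weight is the source of the
    contraction constant 1/2.\<close>
  have diff: "norm (integral {0..t} (I y) - integral {0..t} (I z)) \<le> dist y z * (exp (2 * L * t) - 1) / 2"
    if "t \<ge> 0" for y z t
  proof -
    have i: "I y integrable_on {0..t}" "I z integrable_on {0..t}"
      by (auto intro!: integrable_continuous_real contI)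
    have hi: "((\<lambda>r. dist y z * (L * exp (2 * L * r))) has_integral
        dist y z / 2 * exp (2 * L * t) - dist y z / 2 * exp (2 * L * 0)) {0..t}"
      by (intro fundamental_theorem_of_calculus that)
         (auto intro!: derivative_eq_intros simp: has_real_derivative_iff_has_vector_derivative[symmetric])
    have "norm (I y r - I z r) \<le> dist y z * (L * exp (2 * L * r))" for r
    proof -
      have "norm (I y r - I z r) \<le> L * norm (exp (2 * L * r) *\<^sub>R (y r - z r))"
        unfolding I_def using lip[of "exp (2 * L * r) *\<^sub>R y r" "exp (2 * L * r) *\<^sub>R z r"]
        by (simp add: scaleR_diff_right)
      also have "\<dots> = L * exp (2 * L * r) * dist (y r) (z r)"
        by (simp add: dist_norm)
      also have "\<dots> \<le> L * exp (2 * L * r) * dist y z"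
        using L by (intro mult_left_mono dist_bounded) auto
      finally show ?thesis by (simp add: mult_ac)
    qed
    then have "norm (integral {0..t} (\<lambda>r. I y r - I z r))
        \<le> integral {0..t} (\<lambda>r. dist y z * (L * exp (2 * L * r)))"
      by (intro integral_norm_bound_integral integrable_diff i has_integral_integrable[OF hi])
    also have "\<dots> = dist y z / 2 * exp (2 * L * t) - dist y z / 2 * exp (2 * L * 0)"
      by (rule integral_unique[OF hi])
    finally have "norm (integral {0..t} (\<lambda>r. I y r - I z r)) \<le>
        dist y z / 2 * exp (2 * L * t) - dist y z / 2 * exp (2 * L * 0)" .
    then show ?thesis using i by (simp add: integral_diff field_simps)
  qed
  \<comment> \<open>\<open>max 0 t\<close> freezes the curve at \<open>x\<close> for negative times,
    since the fixed point is sought among bounded continuous functions on the whole line.\<close>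
  define G where "G x y t = exp (- (2 * L * max 0 t)) *\<^sub>R (x + integral {0..max 0 t} (I y))" for x y t
  have I0: "I 0 = (\<lambda>_. 0)" by (auto simp: I_def f0)
  have Gdiff: "norm (G x y t - G x' z t) \<le> norm (x - x') + dist y z / 2" for x x' y z t
  proof -
    define s where "s = max 0 t"
    have s: "s \<ge> 0" by (simp add: s_def)
    have "norm (G x y t - G x' z t)
        = exp (- (2 * L * s)) * norm ((x - x') + (integral {0..s} (I y) - integral {0..s} (I z)))"
      unfolding G_def s_def[symmetric] scaleR_diff_right[symmetric] norm_scaleR by (simp add: algebra_simps)
    also have "\<dots> \<le> exp (- (2 * L * s)) * (norm (x - x') + dist y z * (exp (2 * L * s) - 1) / 2)"
      by (intro mult_left_mono order_trans[OF norm_triangle_ineq] add_left_mono diff s) auto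
    also have "\<dots> = exp (- (2 * L * s)) * norm (x - x') + dist y z / 2 * (1 - exp (- (2 * L * s)))"
      by (simp add: exp_minus field_simps)
    also have "\<dots> \<le> 1 * norm (x - x') + dist y z / 2 * 1"
      using L s by (intro add_mono mult_right_mono mult_left_mono) auto
    finally show ?thesis by simp
  qed
  have G0: "G 0 0 t = 0" for t
    by (simp add: G_def I0)
  have Gb: "G x y \<in> bcontfun" for x y
  proof (rule bcontfun_normI)
    show "continuous_on UNIV (G x y)"
      unfolding G_def
      by (intro continuous_intros continuous_on_compose2[OF contJ]) auto
    show "norm (G x y t) \<le> norm x + dist y 0 / 2" for t
      using Gdiff[of x y t 0 0] by (simp add: G0)
  qed
  define \<Gamma> where "\<Gamma> x y = Bcontfun (G x y)" for x y
  have \<Gamma>: "apply_bcontfun (\<Gamma> x y) = G x y" for x y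
    unfolding \<Gamma>_def using Gb by (rule Bcontfun_inverse)
  have \<Gamma>diff: "dist (\<Gamma> x y) (\<Gamma> x' z) \<le> norm (x - x') + dist y z / 2" for x x' y z
    by (rule dist_bound) (use Gdiff in \<open>simp add: \<Gamma> dist_norm\<close>)
  have "\<exists>y. \<Gamma> x y = y" for x
    using banach_fix_type[of "1/2" "\<Gamma> x"] \<Gamma>diff[of x _ x] by auto
  then obtain Y where Y: "\<And>x. \<Gamma> x (Y x) = Y x" by metis
  define \<phi> where "\<phi> x t = exp (2 * L * t) *\<^sub>R apply_bcontfun (Y x) t" for x t
  have phi_eq: "\<phi> x t = x + integral {0..t} (I (Y x))" if "t \<ge> 0" for x t
  proof -
    have "apply_bcontfun (Y x) t = G x (Y x) t" by (metis Y \<Gamma>)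
    then show ?thesis using that
      by (simp add: \<phi>_def G_def exp_minus)
  qed
  show ?thesis
  proof (rule that)
    show "\<phi> x 0 = x" for x using phi_eq[of 0 x] by simp
    show "(\<phi> x has_vector_derivative f (\<phi> x t)) (at t within {0..})" if "t \<ge> 0" for x t
    proof -
      have "((\<lambda>t. x + integral {0..t} (I (Y x))) has_vector_derivative f (\<phi> x t)) (at t within {0..})"
        using integral_has_vector_derivative_half_line[OF contI that, of "Y x"]
        by (auto intro!: derivative_eq_intros simp: I_def \<phi>_def)
      then show ?thesis
        by (rule has_vector_derivative_transform[rotated 2]) (use that phi_eq in auto)
    qed
    show "norm (\<phi> x t - \<phi> y t) \<le> 2 * exp (2 * L * t) * norm (x - y)" for x y t
    proof -
      \<comment> \<open>Half of the distance between the fixed points is absorbed on the left,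
        whence the factor 2 in the claim.\<close>
      have "dist (Y x) (Y y) \<le> norm (x - y) + dist (Y x) (Y y) / 2"
        using \<Gamma>diff[of x "Y x" y "Y y"] by (simp add: Y)
      then have "dist (Y x t) (Y y t) \<le> 2 * norm (x - y)"
        using dist_bounded[of "Y x" t "Y y"] by linarith
      then show ?thesis
        by (simp add: \<phi>_def dist_norm flip: scaleR_diff_right)
    qed
  qed
qed

section \<open>Truncated systems\<close>

lemma deriv_nonpos_imp_le:
  fixes f :: "real \<Rightarrow> real"
  assumes "s \<le> t" and "{s..t} \<subseteq> S"
    and "\<And>u. u \<in> {s..t} \<Longrightarrow> (f has_real_derivative f' u) (at u within S)"
    and "\<And>u. u \<in> {s..t} \<Longrightarrow> f' u \<le> 0"
  shows "f t \<le> f s"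
proof -
  have "\<exists>u\<in>{s..t}. f t - f s = (\<lambda>h. f' u * h) (t - s)"
    by (rule mvt_very_simple[OF assms(1)])
      (use assms(2,3) in \<open>auto intro!: has_derivative_subset[OF _ assms(2)] simp: has_field_derivative_def\<close>)
  then obtain u where "u \<in> {s..t}" "f t - f s = f' u * (t - s)"
    by auto
  moreover have "f' u * (t - s) \<le> 0"
    using \<open>u \<in> {s..t}\<close> assms(1,4) by (intro mult_nonpos_nonneg) auto
  ultimately show ?thesis by simp
qed

text \<open>The integrating factor \<open>exp (c * u)\<close> turns the inequality into
  monotonicity. Applied to the negative of a mode, it gives lower bounds.\<close>

lemma deriv_le_imp_exp_decay:
  fixes f :: "real \<Rightarrow> real"
  assumes "s \<le> t" and "{s..t} \<subseteq> S"
    and "\<And>u. u \<in> {s..t} \<Longrightarrow> (f has_real_derivative f' u) (at u within S)"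
    and "\<And>u. u \<in> {s..t} \<Longrightarrow> f' u \<le> - c * f u"
  shows "f t \<le> f s * exp (- c * (t - s))"
proof -
  have "f t * exp (c * t) \<le> f s * exp (c * s)"
  proof (rule deriv_nonpos_imp_le[OF assms(1,2)])
    fix u assume u: "u \<in> {s..t}"
    show "((\<lambda>u. f u * exp (c * u)) has_real_derivative (f' u + c * f u) * exp (c * u)) (at u within S)"
      by (auto intro!: derivative_eq_intros assms(3) u simp: algebra_simps)
    show "(f' u + c * f u) * exp (c * u) \<le> 0"
      using assms(4)[OF u] by (intro mult_nonpos_nonneg) auto
  qed
  then have "f t * exp (c * t) * exp (- c * t) \<le> f s * exp (c * s) * exp (- c * t)"
    by (rule mult_right_mono) simp
  then show ?thesis
    by (simp add: algebra_simps flip: exp_add)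
qed

text \<open>\<open>q\<close> stands for the square of the paper's \<open>\<lambda>\<close>, so that \<open>q ^ k\<close> is \<open>N_k^2\<close>.\<close>

definition dyadic_rhs :: "real \<Rightarrow> real \<Rightarrow> (nat \<Rightarrow> real) \<Rightarrow> nat \<Rightarrow> real" where
  "dyadic_rhs \<nu> q x k = - \<nu> * q ^ k * x k + q ^ k * (x (k + 1))\<^sup>2 - q ^ (k - 1) * x (k - 1) * x k"

text \<open>The flux \<open>q ^ k * x k * (x (k + 1))\<^sup>2\<close> enters mode \<open>k\<close>
  and leaves mode \<open>k + 1\<close>, so the sum telescopes to dissipation and two boundary
  fluxes. The induction starts at the empty range \<open>b = a - 1\<close>, where these two
  coincide.\<close>

lemma sum_dyadic_rhs:
  assumes "a \<ge> 1" and "a - 1 \<le> b"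
  shows "(\<Sum>k=a..b. 2 * x k * dyadic_rhs \<nu> q x k) =
    - 2 * \<nu> * (\<Sum>k=a..b. q ^ k * (x k)\<^sup>2) + 2 * (q ^ b * x b * (x (b + 1))\<^sup>2)
    - 2 * (q ^ (a - 1) * x (a - 1) * (x a)\<^sup>2)"
  using assms(2)
proof (induction b rule: dec_induct)
  case base
  then show ?case using assms(1) by simp
next
  case (step b)
  then have "a \<le> Suc b" by simp
  then show ?case using step.IH
    by (simp add: dyadic_rhs_def algebra_simps power2_eq_square)
qed

text \<open>The equations are imposed for every \<open>k \<ge> 1\<close>. For \<open>k > n\<close>
  both sides vanish, so a truncated solution is also a solution of the full system.\<close>

locale truncated_dyadic =
  fixes \<nu> q :: real and n :: nat and X :: "real \<Rightarrow> nat \<Rightarrow> real"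
  assumes nu_pos: "\<nu> > 0" and q_gt_1: "q > 1"
    and nonneg: "t \<ge> 0 \<Longrightarrow> X t k \<ge> 0"
    and X_0: "t \<ge> 0 \<Longrightarrow> X t 0 = 0"
    and X_beyond: "t \<ge> 0 \<Longrightarrow> n < k \<Longrightarrow> X t k = 0"
    and deriv: "t \<ge> 0 \<Longrightarrow> k \<ge> 1 \<Longrightarrow>
      ((\<lambda>u. X u k) has_real_derivative dyadic_rhs \<nu> q (X t) k) (at t within {0..})"
begin

lemma deriv_energy:
  assumes "t \<ge> 0" and "a \<ge> 1" and "a - 1 \<le> b"
  shows "((\<lambda>u. \<Sum>k=a..b. (X u k)\<^sup>2) has_real_derivative
    - 2 * \<nu> * (\<Sum>k=a..b. q ^ k * (X t k)\<^sup>2) + 2 * (q ^ b * X t b * (X t (b + 1))\<^sup>2)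
    - 2 * (q ^ (a - 1) * X t (a - 1) * (X t a)\<^sup>2)) (at t within {0..})"
  unfolding sum_dyadic_rhs[OF assms(2,3), symmetric]
  using assms by (auto intro!: DERIV_sum derivative_eq_intros deriv)

definition energy :: "nat \<Rightarrow> real \<Rightarrow> real" where
  "energy m t = (\<Sum>k=m..n. (X t k)\<^sup>2)"

lemma energy_nonneg: "energy m t \<ge> 0"
  unfolding energy_def by (intro sum_nonneg) auto

lemma energy_split: "m \<le> n \<Longrightarrow> energy m t = (X t m)\<^sup>2 + energy (Suc m) t"
  unfolding energy_def by (rule sum.atLeast_Suc_atMost)

lemma X_le_energy:
  assumes "t \<ge> 0" and "m \<le> k"
  shows "(X t k)\<^sup>2 \<le> energy m t"
proof (cases "k \<le> n")
  case True
  then show ?thesis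
    unfolding energy_def using assms by (intro member_le_sum) auto
next
  case False
  then show ?thesis using X_beyond assms energy_nonneg by simp
qed

text \<open>No energy enters the tail from above mode \<open>n\<close>, the flux down to mode
  \<open>m - 1\<close> only removes energy, and every mode of the tail dissipates at rate at least
  \<open>2 * \<nu> * q ^ m\<close>.\<close>

lemma energy_decay:
  assumes "0 \<le> s" and "s \<le> t" and "m \<ge> 1"
  shows "energy m t \<le> energy m s * exp (- (2 * \<nu> * q ^ m) * (t - s))"
proof (cases "m \<le> n")
  case True
  show ?thesis
  proof (rule deriv_le_imp_exp_decay[where S = "{0..}"])
    fix u assume u: "u \<in> {s..t}"
    then have u0: "u \<ge> 0" using assms by simp
    show "(energy m has_real_derivative
        - 2 * \<nu> * (\<Sum>k=m..n. q ^ k * (X u k)\<^sup>2) + 2 * (q ^ n * X u n * (X u (n + 1))\<^sup>2)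
        - 2 * (q ^ (m - 1) * X u (m - 1) * (X u m)\<^sup>2)) (at u within {0..})"
      unfolding energy_def[abs_def] using deriv_energy[OF u0, of m n] True assms(3) by simp
    have "q ^ m * energy m u \<le> (\<Sum>k=m..n. q ^ k * (X u k)\<^sup>2)"
      unfolding energy_def sum_distrib_left
      using q_gt_1 by (intro sum_mono mult_right_mono power_increasing) auto
    then have "\<nu> * (q ^ m * energy m u) \<le> \<nu> * (\<Sum>k=m..n. q ^ k * (X u k)\<^sup>2)"
      using nu_pos by (intro mult_left_mono) auto
    moreover have "q ^ (m - 1) * X u (m - 1) * (X u m)\<^sup>2 \<ge> 0"
      using nonneg[OF u0] q_gt_1 by (intro mult_nonneg_nonneg) auto
    moreover have "X u (n + 1) = 0"
      using X_beyond[OF u0] by simp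
    ultimately show "- 2 * \<nu> * (\<Sum>k=m..n. q ^ k * (X u k)\<^sup>2) + 2 * (q ^ n * X u n * (X u (n + 1))\<^sup>2)
        - 2 * (q ^ (m - 1) * X u (m - 1) * (X u m)\<^sup>2) \<le> - (2 * \<nu> * q ^ m) * energy m u"
      by (simp add: mult.assoc)
  qed (use assms in auto)
next
  case False
  then show ?thesis by (simp add: energy_def)
qed

text \<open>
  If mode \<open>k + 1\<close> ever reaches a height \<open>A\<close>, it decays at rate at most \<open>b\<close> afterwards, and meanwhile
  feeds mode \<open>k\<close>, which therefore reaches \<open>A^2 / (4 (\<nu> q + M))\<close> at the time when \<open>exp (- b (t - t0))\<close>
  has dropped to 1/2.
\<close>

lemma growth_step:
  assumes k: "k \<ge> 1" and M: "\<And>t. t \<ge> 0 \<Longrightarrow> X t k \<le> M" "\<And>t. t \<ge> 0 \<Longrightarrow> X t (k - 1) \<le> M"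
    and t0: "t0 \<ge> 0"
  shows "X t0 (k + 1) \<le> 2 * M + \<nu> * q"
proof -
  have M0: "M \<ge> 0" using M(1)[of 0] nonneg[of 0 k] by simp
  have qk: "q ^ k > 0" "q ^ (k - 1) \<le> q ^ k" "q ^ (k + 1) = q * q ^ k"
    using q_gt_1 by (auto intro: power_increasing)
  \<comment> \<open>One rate that dominates the damping of both modes:
    \<open>\<nu> * q ^ (k + 1) + q ^ k * X u k\<close> in mode \<open>k + 1\<close>, and
    \<open>\<nu> * q ^ k + q ^ (k - 1) * X u (k - 1)\<close> in mode \<open>k\<close>.\<close>
  define b where "b = q ^ k * (\<nu> * q + M)"
  have b: "b > 0" unfolding b_def using qk M0 nu_pos q_gt_1 by (intro mult_pos_pos add_pos_nonneg) auto
  define A where "A = X t0 (k + 1)"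
  have A0: "A \<ge> 0" using nonneg t0 by (simp add: A_def)
  define T where "T = t0 + ln 2 / b"
  have T: "t0 \<le> T" "0 \<le> T" using b t0 by (auto simp: T_def)
  have low: "A * exp (- b * (u - t0)) \<le> X u (k + 1)" if u: "u \<ge> t0" for u
  proof -
    have "- X u (k + 1) \<le> - X t0 (k + 1) * exp (- b * (u - t0))"
    proof (rule deriv_le_imp_exp_decay[OF u, where S = "{0..}"])
      fix v assume "v \<in> {t0..u}"
      then have v: "v \<ge> 0" using t0 by simp
      show "((\<lambda>u. - X u (k + 1)) has_real_derivative - dyadic_rhs \<nu> q (X v) (k + 1)) (at v within {0..})"
        by (intro DERIV_minus deriv v) simp
      have "q ^ k * X v k * X v (k + 1) \<le> q ^ k * M * X v (k + 1)"
        using M(1)[OF v] nonneg[OF v] qk by (intro mult_right_mono mult_left_mono) auto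
      moreover have "q ^ (k + 1) * (X v (k + 2))\<^sup>2 \<ge> 0"
        using q_gt_1 by simp
      ultimately show "- dyadic_rhs \<nu> q (X v) (k + 1) \<le> - b * - X v (k + 1)"
        by (simp add: dyadic_rhs_def b_def algebra_simps)
    qed (use t0 in auto)
    then show ?thesis by (simp add: A_def)
  qed
  \<comment> \<open>The derivative of the last term is minus the guaranteed gain of mode
    \<open>k\<close> from mode \<open>k + 1\<close>, weighted by \<open>exp (b * (u - t0))\<close>;
    hence \<open>g\<close> cannot decrease. With \<open>Z = q ^ k * A\<^sup>2 / b\<close>, comparing
    \<open>t0\<close> and \<open>T\<close> gives \<open>Z \<le> 2 * X T k + Z / 2\<close>.\<close>
  define g where "g u = X u k * exp (b * (u - t0)) + q ^ k * A\<^sup>2 / b * exp (- b * (u - t0))" for u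
  have "- g T \<le> - g t0"
  proof (rule deriv_nonpos_imp_le[OF T(1), where S = "{0..}"])
    fix u assume "u \<in> {t0..T}"
    then have u: "u \<ge> 0" "u \<ge> t0" using t0 by auto
    show "((\<lambda>u. - g u) has_real_derivative
      - ((dyadic_rhs \<nu> q (X u) k + b * X u k) * exp (b * (u - t0)) - q ^ k * A\<^sup>2 * exp (- b * (u - t0))))
        (at u within {0..})"
      unfolding g_def using b
      by (auto intro!: derivative_eq_intros deriv u k simp: field_simps)
    have e: "exp (- b * (u - t0)) = exp (- b * (u - t0)) ^ 2 * exp (b * (u - t0))"
      by (simp add: power2_eq_square flip: exp_add)
    have "(A * exp (- b * (u - t0)))\<^sup>2 \<le> (X u (k + 1))\<^sup>2"
      using low[OF u(2)] A0 by (intro power_mono) auto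
    then have "q ^ k * (A * exp (- b * (u - t0)))\<^sup>2 \<le> q ^ k * (X u (k + 1))\<^sup>2"
      using qk by (intro mult_left_mono) auto
    also have "\<dots> \<le> dyadic_rhs \<nu> q (X u) k + b * X u k"
    proof -
      have "\<nu> * q ^ k * X u k \<le> \<nu> * q * q ^ k * X u k"
        using nonneg[OF u(1)] nu_pos q_gt_1 qk
        by (intro mult_right_mono) auto
      moreover have "q ^ (k - 1) * X u (k - 1) * X u k \<le> q ^ k * M * X u k"
        using M(2)[OF u(1)] nonneg[OF u(1)] qk M0
        by (intro mult_right_mono mult_mono) auto
      ultimately show ?thesis
        by (simp add: dyadic_rhs_def b_def algebra_simps)
    qed
    finally have "q ^ k * (A * exp (- b * (u - t0)))\<^sup>2 * exp (b * (u - t0))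
        \<le> (dyadic_rhs \<nu> q (X u) k + b * X u k) * exp (b * (u - t0))"
      by (rule mult_right_mono) simp
    moreover have "q ^ k * (A * exp (- b * (u - t0)))\<^sup>2 * exp (b * (u - t0)) = q ^ k * A\<^sup>2 * exp (- b * (u - t0))"
      by (subst (2) e) (simp add: power_mult_distrib)
    ultimately show "- ((dyadic_rhs \<nu> q (X u) k + b * X u k) * exp (b * (u - t0)) - q ^ k * A\<^sup>2 * exp (- b * (u - t0))) \<le> 0"
      by linarith
  qed (use t0 in auto)
  moreover have "g t0 \<ge> Z" if "Z = q ^ k * A\<^sup>2 / b" for Z
    using nonneg[OF t0] by (simp add: g_def that)
  moreover have "g T = X T k * 2 + Z / 2" if "Z = q ^ k * A\<^sup>2 / b" for Z
    using b by (simp add: g_def T_def exp_minus that)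
  ultimately have "Z \<le> 4 * M" if "Z = q ^ k * A\<^sup>2 / b" for Z
    using M(1)[OF T(2)] that by fastforce
  then have "q ^ k * A\<^sup>2 / b \<le> 4 * M" by blast
  then have "q ^ k * A\<^sup>2 \<le> q ^ k * (4 * M * (\<nu> * q + M))"
    using b by (simp add: b_def field_simps)
  then have "A\<^sup>2 \<le> 4 * M * (\<nu> * q + M)" using qk(1) by simp
  \<comment> \<open>The two sides differ by the square of \<open>\<nu> * q\<close>.\<close>
  also have "\<dots> \<le> (2 * M + \<nu> * q)\<^sup>2"
    using zero_le_square[of "\<nu> * q"] by (simp add: power2_eq_square algebra_simps)
  finally show ?thesis
    unfolding A_def[symmetric] by (rule power2_le_imp_le) (use M0 nu_pos q_gt_1 in auto)
qed

lemma growth: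
  assumes "\<And>t. t \<ge> 0 \<Longrightarrow> X t 1 \<le> 1" and "t \<ge> 0"
  shows "X t k \<le> (1 + \<nu> * q) * 2 ^ k"
proof -
  have nq: "\<nu> * q > 0" using nu_pos q_gt_1 by simp
  \<comment> \<open>The solution of the recursion in \<open>growth_step\<close> with
    \<open>M 0 = 1\<close>.\<close>
  define M where "M k = (1 + \<nu> * q) * 2 ^ k - \<nu> * q" for k :: nat
  have MS: "M (Suc k) = 2 * M k + \<nu> * q" for k by (simp add: M_def algebra_simps)
  have M1: "M k \<ge> 1" for k
    by (induction k) (use MS nq in \<open>auto simp: M_def[of 0]\<close>)
  have "\<forall>t\<ge>0. X t k \<le> M k \<and> X t (Suc k) \<le> M (Suc k)" for k
  proof (induction k)
    case 0
    show ?case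
      using assms(1) M1[of 0] M1[of "Suc 0"] X_0 by fastforce
  next
    case (Suc k)
    have "X t (Suc k + 1) \<le> 2 * M (Suc k) + \<nu> * q" if "t \<ge> 0" for t
    proof (rule growth_step)
      show "X t (Suc k - 1) \<le> M (Suc k)" if "t \<ge> 0" for t
        using Suc.IH that MS[of k] M1[of k] nq by fastforce
    qed (use Suc.IH that in auto)
    then show ?case using Suc.IH MS by simp
  qed
  then have "X t k \<le> M k" using assms(2) by blast
  then show ?thesis using nq by (simp add: M_def)
qed

end

section \<open>Uniform smoothing at positive times and the energy lower bound\<close>

text \<open>
  A closed form whose decrements \<open>smoothing_time m - smoothing_time (m + 1)\<close> are just long enough
  for dissipation to bring the energy above mode \<open>m\<close> from \<open>(8 B^2)^(m + 1)\<close> down to 1.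
\<close>

definition smoothing_time :: "real \<Rightarrow> real \<Rightarrow> real \<Rightarrow> nat \<Rightarrow> real" where
  "smoothing_time \<nu> q B m = ln (8 * B\<^sup>2) / (2 * \<nu>) * (q / (q - 1)) * ((real m + 1 + 1 / (q - 1)) / q ^ m)"

text \<open>Up to the factor \<open>ln (8 * B\<^sup>2) / (2 * \<nu>)\<close>,
  \<open>smoothing_time\<close> is the sum of \<open>(j + 1) / q ^ j\<close> over
  \<open>j \<ge> m\<close>; one step removes the first term.\<close>

lemma smoothing_time_step:
  assumes "q > 1"
  shows "smoothing_time \<nu> q B m =
    smoothing_time \<nu> q B (Suc m) + ln (8 * B\<^sup>2) / (2 * \<nu>) * ((real m + 1) / q ^ m)"
proof -
  define p where "p = q - 1"
  have p: "p > 0" "p \<noteq> 0" "1 + p \<noteq> 0" "q = p + 1" using assms by (auto simp: p_def)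
  have "q / (q - 1) * ((real m + 1 + 1 / (q - 1)) / q ^ m) =
    q / (q - 1) * ((real (Suc m) + 1 + 1 / (q - 1)) / q ^ Suc m) + (real m + 1) / q ^ m"
    using p(1) by (simp add: p(4) divide_simps) (auto simp: algebra_simps)
  then show ?thesis
    unfolding smoothing_time_def
    by (metis (no_types, opaque_lifting) mult.assoc distrib_left)
qed

lemma smoothing_time_tendsto_0:
  assumes "q > 1"
  shows "smoothing_time \<nu> q B \<longlonglongrightarrow> 0"
proof -
  have "(\<lambda>m. (real m + 1 + 1 / (q - 1)) / q ^ m) \<longlonglongrightarrow> 0"
    using assms by real_asymp
  then show ?thesis
    unfolding smoothing_time_def[abs_def] by (rule tendsto_mult_right_zero)
qed

context truncated_dyadic
begin

text \<open>Induction downwards in \<open>m\<close>, from the empty tails \<open>m > n\<close>. At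
  the smoothing time of \<open>Suc m\<close> the energy above mode \<open>m\<close> is at most 1 and
  mode \<open>m\<close> obeys the growth bound; the remaining wait brings their sum down to 1. The
  waiting times do not depend on \<open>n\<close>.\<close>

lemma energy_le_1:
  assumes B: "B \<ge> 1" "\<And>t k. t \<ge> 0 \<Longrightarrow> X t k \<le> B * 2 ^ k"
    and "m \<ge> 1" and "t \<ge> smoothing_time \<nu> q B m"
  shows "energy m t \<le> 1"
  using assms(3,4)
proof (induction "Suc n - m" arbitrary: m t)
  case 0
  then show ?case by (simp add: energy_def)
next
  case (Suc d)
  then have m: "m \<le> n" by simp
  define s where "s = smoothing_time \<nu> q B (Suc m)"
  define l where "l = ln (8 * B\<^sup>2)"
  have B2: "B\<^sup>2 \<ge> 1" using B(1) by simp
  then have l: "l \<ge> 0" "exp l = 8 * B\<^sup>2" unfolding l_def by auto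
  have s: "s \<ge> 0"
    using q_gt_1 nu_pos l(1) unfolding s_def smoothing_time_def l_def[symmetric] by simp
  have st: "t - s \<ge> l / (2 * \<nu>) * ((real m + 1) / q ^ m)"
    using Suc.prems(2) smoothing_time_step[OF q_gt_1, of \<nu> B m] by (simp add: s_def l_def)
  have "l / (2 * \<nu>) * ((real m + 1) / q ^ m) \<ge> 0"
    using q_gt_1 nu_pos l by simp
  then have "s \<le> t" using st by linarith
  have "2 * \<nu> * q ^ m * (t - s) \<ge> 2 * \<nu> * q ^ m * (l / (2 * \<nu>) * ((real m + 1) / q ^ m))"
    using st nu_pos q_gt_1 by (intro mult_left_mono) auto
  also have "2 * \<nu> * q ^ m * (l / (2 * \<nu>) * ((real m + 1) / q ^ m)) = real (Suc m) * l"
    using nu_pos q_gt_1 by (simp add: field_simps)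
  finally have ex: "exp (- (2 * \<nu> * q ^ m) * (t - s)) \<le> exp (- (real (Suc m) * l))"
    by simp
  have "energy m s \<le> (B * 2 ^ m)\<^sup>2 + 1"
    unfolding energy_split[OF m]
    using Suc.hyps(1)[of "Suc m" s] Suc.hyps(2) B(2)[OF s] nonneg[OF s]
    by (intro add_mono power_mono) (auto simp: s_def)
  \<comment> \<open>A single base to the power \<open>m + 1\<close> has a logarithm linear in
    \<open>m + 1\<close>, which matches the waiting time.\<close>
  also have "\<dots> \<le> (8 * B\<^sup>2) ^ Suc m"
  proof -
    have "(B * 2 ^ m)\<^sup>2 = B\<^sup>2 * 4 ^ m" 
      by (simp add: power_mult_distrib power2_eq_square flip: power_mult_distrib)
    moreover have "(1::real) \<le> B\<^sup>2 * 4 ^ m"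
      using mult_mono[of 1 "B\<^sup>2" 1 "4 ^ m :: real"] B2 by simp
    moreover have "B\<^sup>2 * 4 ^ m \<le> B\<^sup>2 * (8 * B\<^sup>2) ^ m"
      using B2 by (intro mult_left_mono power_mono) auto
    moreover have "B\<^sup>2 * (8 * B\<^sup>2) ^ m \<ge> 0" by simp
    ultimately show ?thesis unfolding power_Suc by linarith
  qed
  also have "\<dots> = exp (real (Suc m) * l)"
    unfolding l(2)[symmetric] exp_of_nat_mult ..
  finally have "energy m s * exp (- (2 * \<nu> * q ^ m) * (t - s))
      \<le> exp (real (Suc m) * l) * exp (- (real (Suc m) * l))"
    using ex by (intro mult_mono energy_nonneg) auto
  then show ?case
    using energy_decay[OF s \<open>s \<le> t\<close> Suc.prems(1)] by (simp flip: exp_add)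
qed

text \<open>Modes below \<open>n\<close> start at 0, and only the term
  \<open>q ^ j * (X u (j + 1))\<^sup>2\<close> can increase mode \<open>j\<close>; the growth bound
  caps this rate.\<close>

lemma low_modes_small_time:
  assumes B: "\<And>t k. t \<ge> 0 \<Longrightarrow> X t k \<le> B * 2 ^ k"
    and X0: "\<And>k. k < n \<Longrightarrow> X 0 k = 0"
    and j: "1 \<le> j" "j < n" and s: "s \<ge> 0"
  shows "X s j \<le> s * (q ^ j * (B * 2 ^ (j + 1))\<^sup>2)"
proof -
  define c where "c = q ^ j * (B * 2 ^ (j + 1))\<^sup>2"
  have "X s j - s * c \<le> X 0 j - 0 * c"
  proof (rule deriv_nonpos_imp_le[OF s, where S = "{0..}"])
    fix u assume "u \<in> {0..s}"
    then have u: "u \<ge> 0" by simp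
    show "((\<lambda>u. X u j - u * c) has_real_derivative dyadic_rhs \<nu> q (X u) j - c) (at u within {0..})"
      by (auto intro!: derivative_eq_intros deriv u j)
    have "q ^ j * (X u (j + 1))\<^sup>2 \<le> c"
      unfolding c_def using B[OF u, of "j + 1"] nonneg[OF u] q_gt_1
      by (intro mult_left_mono power_mono) auto
    moreover have "\<nu> * q ^ j * X u j \<ge> 0" "q ^ (j - 1) * X u (j - 1) * X u j \<ge> 0"
      using nu_pos q_gt_1 nonneg[OF u] by auto
    ultimately show "dyadic_rhs \<nu> q (X u) j - c \<le> 0"
      unfolding dyadic_rhs_def by linarith
  qed auto
  then show ?thesis using X0[OF j(2)] by (simp add: c_def)
qed

lemma low_energy_small_time:
  assumes B: "\<And>t k. t \<ge> 0 \<Longrightarrow> X t k \<le> B * 2 ^ k"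
    and X0: "\<And>k. k < n \<Longrightarrow> X 0 k = 0"
    and K: "k \<le> K" "K < n" and s: "0 \<le> s" "s \<le> t"
    and t: "8 * B\<^sup>2 * t * (8 * q) ^ K \<le> 1"
  shows "(\<Sum>j=1..k. (X s j)\<^sup>2) \<le> 1 / 2"
proof -
  define c where "c = t * (q ^ K * (B * 2 ^ (K + 1))\<^sup>2)"
  have c: "c = 4 * B\<^sup>2 * t * (4 * q) ^ K"
  proof -
    have "((2::real) ^ (K + 1))\<^sup>2 = 4 * 4 ^ K"
      by (simp add: power2_eq_square flip: power_mult_distrib)
    then show ?thesis by (simp add: c_def power_mult_distrib)
  qed
  have B0: "B \<ge> 0" using B[OF s(1), of 0] nonneg[OF s(1), of 0] by simp
  have c0: "c \<ge> 0" using q_gt_1 s by (simp add: c)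
  have "(X s j)\<^sup>2 \<le> c\<^sup>2" if "j \<in> {1..k}" for j
  proof (rule power_mono)
    have "X s j \<le> s * (q ^ j * (B * 2 ^ (j + 1))\<^sup>2)"
      using that K s by (intro low_modes_small_time B X0) auto
    also have "\<dots> \<le> c"
      unfolding c_def using that K s q_gt_1 B0 by (intro mult_mono power_increasing power_mono) auto
    finally show "X s j \<le> c" .
  qed (use nonneg s in auto)
  then have "(\<Sum>j=1..k. (X s j)\<^sup>2) \<le> real k * c\<^sup>2"
    using sum_bounded_above[of "{1..k}" "\<lambda>j. (X s j)\<^sup>2" "c\<^sup>2"] by simp
  \<comment> \<open>The number of modes is absorbed into a factor \<open>2 ^ K\<close>, which turns
    \<open>(4 * q) ^ K\<close> into the \<open>(8 * q) ^ K\<close> of the hypothesis.\<close>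
  also have "\<dots> \<le> (2 ^ K)\<^sup>2 * c\<^sup>2"
  proof (rule mult_right_mono)
    have "real k \<le> 2 ^ K"
      using K(1) of_nat_less_two_power[of K, where 'a = real] by linarith
    also have "\<dots> \<le> (2 ^ K)\<^sup>2" by (rule self_le_power) auto
    finally show "real k \<le> (2 ^ K)\<^sup>2" .
  qed simp
  also have "\<dots> = (4 * B\<^sup>2 * t * (8 * q) ^ K)\<^sup>2"
  proof -
    have "(8 * q) ^ K = 2 ^ K * (4 * q) ^ K"
      using power_mult_distrib[of 2 "4 * q" K] by simp
    then have "2 ^ K * c = 4 * B\<^sup>2 * t * (8 * q) ^ K"
      unfolding c by (simp only: mult_ac)
    then show ?thesis by (metis power_mult_distrib)
  qed
  also have "\<dots> \<le> (1 / 2)\<^sup>2"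
    using t s q_gt_1 by (intro power_mono) auto
  finally show ?thesis by (simp add: power2_eq_square)
qed

text \<open>
  The energy in the modes up to \<open>k\<close> grows only through the flux \<open>q^k X_k X_(k+1)^2\<close>, which is at most
  \<open>sqrt (energy 1 t) / q\<close> times the dissipation density \<open>q^(k+1) X_(k+1)^2\<close>. Each of \<open>K\<close> different
  thresholds \<open>k\<close> thus costs a fixed amount of \<open>energy 1 t\<close>; the functional \<open>G\<close> does this bookkeeping.
\<close>

lemma energy_lower_bound:
  assumes B: "\<And>t k. t \<ge> 0 \<Longrightarrow> X t k \<le> B * 2 ^ k"
    and X0: "\<And>k. k < n \<Longrightarrow> X 0 k = 0"
    and T: "T \<ge> 0" "X T 1 = 1"
    and K: "1 \<le> K" "K < n" and t: "t \<ge> 0" "8 * B\<^sup>2 * t * (8 * q) ^ K \<le> 1"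
  shows "\<nu> * q / 2 * real K \<le> sqrt (energy 1 t) ^ 3"
proof -
  note small = low_energy_small_time[OF B X0 _ K(2) _ _ t(2)]
  \<comment> \<open>Mode 1 alone has energy 1 at time \<open>T\<close>, more than the low modes can
    hold up to time \<open>t\<close>.\<close>
  have "t \<le> T"
  proof (rule ccontr)
    assume "\<not> t \<le> T"
    then have "(\<Sum>j=1..1. (X T j)\<^sup>2) \<le> 1 / 2"
      using T K by (intro small) auto
    then show False using T by simp
  qed
  define r where "r = sqrt (energy 1 t)"
  have r: "r \<ge> 0" "r\<^sup>2 = energy 1 t" using energy_nonneg by (auto simp: r_def)
  have Xr: "X s k \<le> r" if "s \<ge> t" "k \<ge> 1" for s k
  proof -
    have "(X s k)\<^sup>2 \<le> energy 1 s" using that t by (intro X_le_energy) auto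
    also have "\<dots> \<le> energy 1 t * exp (- (2 * \<nu> * q ^ 1) * (s - t))"
      using that t by (intro energy_decay) auto
    also have "\<dots> \<le> energy 1 t"
      using that nu_pos q_gt_1 energy_nonneg by (intro mult_right_le_one_le) auto
    finally show ?thesis unfolding r_def by (rule real_le_rsqrt)
  qed
  \<comment> \<open>With the weight \<open>r / (\<nu> * q)\<close>, the dissipation
    \<open>2 * \<nu> * q * S\<close> of the total energy exactly pays for the fluxes
    \<open>2 * r * S\<close>, with \<open>S\<close> as below. Each inner sum is at most 1/2 at time
    \<open>t\<close> and at least 1 at time \<open>T\<close>.\<close>
  define G where "G s = (\<Sum>k=1..K. \<Sum>j=1..k. (X s j)\<^sup>2) + r / (\<nu> * q) * (\<Sum>k=1..n. (X s k)\<^sup>2)" for s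
  have "G T \<le> G t"
  proof (rule deriv_nonpos_imp_le[OF \<open>t \<le> T\<close>, where S = "{0..}"])
    fix u assume "u \<in> {t..T}"
    then have u: "u \<ge> 0" "u \<ge> t" using t by auto
    let ?D = "\<lambda>k. - 2 * \<nu> * (\<Sum>j=1..k. q ^ j * (X u j)\<^sup>2) + 2 * (q ^ k * X u k * (X u (k + 1))\<^sup>2)
      - 2 * (q ^ (1 - 1) * X u (1 - 1) * (X u 1)\<^sup>2)"
    show "(G has_real_derivative (\<Sum>k=1..K. ?D k) + r / (\<nu> * q) * ?D n) (at u within {0..})"
      unfolding G_def[abs_def] using u by (intro DERIV_add DERIV_cmult DERIV_sum deriv_energy) auto
    have D: "?D k \<le> 2 * r * (q ^ k * (X u (k + 1))\<^sup>2)" if "k \<in> {1..K}" for k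
    proof -
      have "q ^ k * X u k * (X u (k + 1))\<^sup>2 \<le> q ^ k * r * (X u (k + 1))\<^sup>2"
        using Xr u that q_gt_1 by (intro mult_right_mono mult_left_mono) auto
      moreover have "\<nu> * (\<Sum>j=1..k. q ^ j * (X u j)\<^sup>2) \<ge> 0"
        using nu_pos q_gt_1 by (intro mult_nonneg_nonneg sum_nonneg) auto
      ultimately show ?thesis using X_0[OF u(1)] by (simp add: mult_ac)
    qed
    define S where "S = (\<Sum>k=1..K. q ^ k * (X u (k + 1))\<^sup>2)"
    have "(\<Sum>k=1..K. ?D k) \<le> 2 * r * S"
      using sum_mono[OF D] by (simp only: S_def sum_distrib_left)
    \<comment> \<open>Different thresholds draw on dissipation in different modes, 2 to
      \<open>K + 1\<close>, all of them present because \<open>K < n\<close>.\<close>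
    moreover have "?D n \<le> - 2 * \<nu> * (q * S)"
    proof -
      have "q * S = (\<Sum>k=1..K. q ^ Suc k * (X u (Suc k))\<^sup>2)"
        by (simp add: S_def sum_distrib_left mult.assoc)
      also have "\<dots> = (\<Sum>k=2..Suc K. q ^ k * (X u k)\<^sup>2)"
        using sum.shift_bounds_cl_Suc_ivl[of "\<lambda>k. q ^ k * (X u k)\<^sup>2" 1 K] by (simp add: numeral_2_eq_2)
      also have "\<dots> \<le> (\<Sum>k=1..n. q ^ k * (X u k)\<^sup>2)"
        using K q_gt_1 by (intro sum_mono2) auto
      finally show ?thesis
        using X_0[OF u(1)] X_beyond[OF u(1)] nu_pos by simp
    qed
    then have "r / (\<nu> * q) * ?D n \<le> r / (\<nu> * q) * (- 2 * \<nu> * (q * S))"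
      using r nu_pos q_gt_1 by (intro mult_left_mono) auto
    moreover have "r / (\<nu> * q) * (- 2 * \<nu> * (q * S)) = - (2 * r * S)"
      using nu_pos q_gt_1 by (simp add: field_simps)
    ultimately show "(\<Sum>k=1..K. ?D k) + r / (\<nu> * q) * ?D n \<le> 0"
      by linarith
  qed (use t in auto)
  moreover have "real K \<le> G T"
  proof -
    have "1 \<le> (\<Sum>j=1..k. (X T j)\<^sup>2)" if "k \<in> {1..K}" for k
      using member_le_sum[of 1 "{1..k}" "\<lambda>j. (X T j)\<^sup>2"] that T by auto
    then have "real K \<le> (\<Sum>k=1..K. \<Sum>j=1..k. (X T j)\<^sup>2)"
      using sum_bounded_below[of "{1..K}" 1 "\<lambda>k. \<Sum>j=1..k. (X T j)\<^sup>2"] by simp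
    moreover have "r / (\<nu> * q) * (\<Sum>k=1..n. (X T k)\<^sup>2) \<ge> 0"
      using r nu_pos q_gt_1 by (intro mult_nonneg_nonneg sum_nonneg) auto
    ultimately show ?thesis unfolding G_def by linarith
  qed
  moreover have "G t \<le> real K * (1 / 2) + r / (\<nu> * q) * r\<^sup>2"
  proof -
    have "(\<Sum>k=1..K. \<Sum>j=1..k. (X t j)\<^sup>2) \<le> real K * (1 / 2)"
      using sum_bounded_above[of "{1..K}" "\<lambda>k. \<Sum>j=1..k. (X t j)\<^sup>2" "1 / 2"] small t by simp
    then show ?thesis unfolding G_def r(2) energy_def by simp
  qed
  ultimately have "real K / 2 \<le> r / (\<nu> * q) * r\<^sup>2" by linarith
  then show ?thesis
    unfolding r_def[symmetric] using nu_pos q_gt_1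
    by (simp add: field_simps power3_eq_cube power2_eq_square)
qed

end

text \<open>With \<open>m\<close> such that \<open>smoothing_time\<close> is below
  \<open>d / 2\<close>, the total energy at \<open>d / 2\<close> is at most 1 plus the growth bounds
  of the modes up to \<open>m\<close>. Afterwards the tail from mode \<open>k\<close> on decays at
  rate \<open>2 * \<nu> * q ^ k\<close>, and \<open>2 * (t - d / 2) \<ge> t\<close>.
  \<open>C\<close> is fixed before \<open>n\<close> and \<open>X\<close>, so the estimate survives
  the limit.\<close>

lemma smoothing_bound:
  assumes "\<nu> > 0" and "q > 1" and B: "B \<ge> 1" and d: "d > (0::real)"
  obtains C where "C > 0"
    and "\<And>n X t k. truncated_dyadic \<nu> q n X \<Longrightarrow> (\<And>t k. t \<ge> 0 \<Longrightarrow> X t k \<le> B * 2 ^ k) \<Longrightarrow> t \<ge> d \<Longrightarrow> k \<ge> 1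
      \<Longrightarrow> (X t k)\<^sup>2 \<le> C * exp (- \<nu> * q ^ k * t)"
proof -
  have "eventually (\<lambda>m. smoothing_time \<nu> q B m < d / 2) sequentially"
    using smoothing_time_tendsto_0[OF \<open>q > 1\<close>] d by (intro order_tendstoD(2)[where y = 0]) auto
  then have "eventually (\<lambda>m. smoothing_time \<nu> q B m < d / 2 \<and> m \<ge> 1) sequentially"
    using eventually_ge_at_top[of 1] by eventually_elim auto
  then obtain m where m: "smoothing_time \<nu> q B m < d / 2" "m \<ge> 1"
    by (metis (no_types, lifting) eventually_sequentially order_refl)
  define C where "C = (\<Sum>k=1..m. (B * 2 ^ k)\<^sup>2) + 1"
  have C: "C > 0" unfolding C_def by (intro add_nonneg_pos sum_nonneg) auto
  show ?thesis
  proof (rule that[OF C])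
    fix n X t k
    assume "truncated_dyadic \<nu> q n X" and XB: "\<And>t k. t \<ge> 0 \<Longrightarrow> X t k \<le> B * 2 ^ k"
      and t: "t \<ge> d" and k: "k \<ge> (1::nat)"
    then interpret truncated_dyadic \<nu> q n X by simp
    have h: "d / 2 \<ge> 0" "d / 2 \<le> t" using d t by auto
    have "energy 1 (d / 2) \<le> (\<Sum>k\<in>{1..m} \<union> {m..n}. (X (d / 2) k)\<^sup>2)"
      unfolding energy_def by (intro sum_mono2) auto
    also have "\<dots> \<le> (\<Sum>k=1..m. (X (d / 2) k)\<^sup>2) + energy m (d / 2)"
      unfolding energy_def by (subst sum_Un) (auto intro: sum_nonneg)
    also have "\<dots> \<le> C"
      unfolding C_def using m XB nonneg h energy_le_1[OF B XB]
      by (intro add_mono sum_mono power_mono) auto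
    finally have E: "energy 1 (d / 2) \<le> C" .
    have "(X t k)\<^sup>2 \<le> energy k t" using h by (intro X_le_energy) auto
    also have "\<dots> \<le> energy k (d / 2) * exp (- (2 * \<nu> * q ^ k) * (t - d / 2))"
      using h k by (intro energy_decay) auto
    also have "\<dots> \<le> C * exp (- \<nu> * q ^ k * t)"
    proof (rule mult_mono)
      have "energy k (d / 2) \<le> energy 1 (d / 2)"
        unfolding energy_def using k by (intro sum_mono2) auto
      then show "energy k (d / 2) \<le> C" using E by simp
      have "\<nu> * q ^ k * t \<le> \<nu> * q ^ k * (2 * (t - d / 2))"
        using t assms by (intro mult_left_mono) auto
      then show "exp (- (2 * \<nu> * q ^ k) * (t - d / 2)) \<le> exp (- \<nu> * q ^ k * t)"
        by (simp add: algebra_simps)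
    qed (use C in auto)
    finally show "(X t k)\<^sup>2 \<le> C * exp (- \<nu> * q ^ k * t)" .
  qed
qed

section \<open>Existence and normalization of truncated solutions\<close>

text \<open>Squaring removes the corner at 0, so the excess over a bound can be differentiated along
  a trajectory.\<close>

lemma has_real_derivative_positive_part_square:
  "((\<lambda>y. (max 0 y)\<^sup>2) has_real_derivative 2 * max 0 x) (at x)" for x :: real
proof -
  consider "x > 0" | "x < 0" | "x = 0" by linarith
  then show ?thesis
  proof cases
    case 1
    have "((\<lambda>y. y\<^sup>2) has_real_derivative 2 * max 0 x) (at x)"
      using 1 by (auto intro!: derivative_eq_intros)
    then show ?thesis
      by (rule has_field_derivative_transform_within_open[where S = "{0<..}"]) (use 1 in auto)
  next
    case 2
    have "((\<lambda>y. 0) has_real_derivative 2 * max 0 x) (at x)"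
      using 2 by (auto intro!: derivative_eq_intros)
    then show ?thesis
      by (rule has_field_derivative_transform_within_open[where S = "{..<0}"]) (use 2 in auto)
  next
    case 3
    have "((\<lambda>h. (max 0 h)\<^sup>2 / h) \<longlongrightarrow> 0) (at (0::real))"
    proof (rule tendsto_sandwich[where f = "\<lambda>h. - \<bar>h\<bar>" and h = "\<lambda>h. \<bar>h\<bar>"])
      show "\<forall>\<^sub>F h in at 0. (max 0 h)\<^sup>2 / h \<le> \<bar>h::real\<bar>"
        "\<forall>\<^sub>F h in at 0. - \<bar>h\<bar> \<le> (max 0 h)\<^sup>2 / (h::real)"
        by (auto intro!: always_eventually simp: max_def power2_eq_square)
    qed (auto intro!: tendsto_eq_intros)
    then show ?thesis
      using 3 by (simp add: DERIV_def)
  qed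
qed

text \<open>
  Clipping makes the quadratic field globally Lipschitz. It is inactive along the trajectories of
  interest, by positivity and by the energy inequality.
\<close>

definition clip :: "real \<Rightarrow> real \<Rightarrow> real" where
  "clip R y = max 0 (min R y)"

definition clip_modes :: "nat \<Rightarrow> real \<Rightarrow> (nat \<Rightarrow> real) \<Rightarrow> nat \<Rightarrow> real" where
  "clip_modes n R x k = (if 1 \<le> k \<and> k \<le> n then clip R (x k) else 0)"

definition clipped_field :: "real \<Rightarrow> real \<Rightarrow> nat \<Rightarrow> real \<Rightarrow> (nat \<Rightarrow> real) \<Rightarrow> nat \<Rightarrow> real" where
  "clipped_field \<nu> q n R x k = (if k = 0 then 0 else dyadic_rhs \<nu> q (clip_modes n R x) k)"

lemma clip_modes_bounds:
  assumes "R \<ge> 0"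
  shows "0 \<le> clip_modes n R x k" "clip_modes n R x k \<le> R"
  using assms by (auto simp: clip_modes_def clip_def)

lemma clip_modes_dist: "\<bar>clip_modes n R x k - clip_modes n R y k\<bar> \<le> \<bar>x k - y k\<bar>"
  by (auto simp: clip_modes_def clip_def)

text \<open>Both quadratic terms are products of entries between 0 and \<open>R\<close>, which
  change by at most \<open>2 * R * d\<close>; beyond mode \<open>n\<close> the field vanishes, so
  \<open>q ^ n\<close> bounds all coefficients.\<close>

lemma clipped_field_lipschitz:
  assumes "\<nu> > 0" and "q > 1" and R: "R \<ge> 0" and d: "\<And>j. \<bar>x j - y j\<bar> \<le> d"
  shows "\<bar>clipped_field \<nu> q n R x k - clipped_field \<nu> q n R y k\<bar> \<le> q ^ n * (\<nu> + 4 * R) * d"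
proof -
  have d0: "d \<ge> 0" using d[of 0] by linarith
  show ?thesis
  proof (cases "1 \<le> k \<and> k \<le> n")
    case False
    then have "clipped_field \<nu> q n R z k = 0" for z
      by (auto simp: clipped_field_def dyadic_rhs_def clip_modes_def)
    then show ?thesis using assms d0 by simp
  next
    case True
    define a where "a = clip_modes n R x"
    define b where "b = clip_modes n R y"
    have ab: "\<bar>a j - b j\<bar> \<le> d" "0 \<le> a j" "0 \<le> b j" "a j \<le> R" "b j \<le> R" for j
      using clip_modes_dist[of n R x j y] d[of j] clip_modes_bounds[OF R] by (auto simp: a_def b_def)
    have prod: "\<bar>a i * a j - b i * b j\<bar> \<le> 2 * R * d" for i j
    proof -
      have "a i * a j - b i * b j = a i * (a j - b j) + b j * (a i - b i)"
        by (simp add: algebra_simps)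
      also have "\<bar>\<dots>\<bar> \<le> \<bar>a i\<bar> * \<bar>a j - b j\<bar> + \<bar>b j\<bar> * \<bar>a i - b i\<bar>"
        by (metis abs_mult abs_triangle_ineq)
      also have "\<dots> \<le> R * d + R * d"
        using ab R by (intro add_mono mult_mono) auto
      finally show ?thesis by simp
    qed
    have qk: "0 < q ^ k" "q ^ k \<le> q ^ n" "0 < q ^ (k - 1)" "q ^ (k - 1) \<le> q ^ n"
      using True assms by (auto intro: power_increasing)
    define u v w where "u = q ^ k * (\<nu> * (a k - b k))"
      and "v = q ^ k * (a (k + 1) * a (k + 1) - b (k + 1) * b (k + 1))"
      and "w = q ^ (k - 1) * (a (k - 1) * a k - b (k - 1) * b k)"
    have "clipped_field \<nu> q n R x k - clipped_field \<nu> q n R y k = - u + v - w"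
      using True by (simp add: clipped_field_def dyadic_rhs_def a_def b_def u_def v_def w_def
          power2_eq_square algebra_simps)
    also have "\<bar>\<dots>\<bar> \<le> \<bar>u\<bar> + \<bar>v\<bar> + \<bar>w\<bar>"
      by linarith
    also have "\<dots> = q ^ k * (\<nu> * \<bar>a k - b k\<bar>) + q ^ k * \<bar>a (k + 1) * a (k + 1) - b (k + 1) * b (k + 1)\<bar>
        + q ^ (k - 1) * \<bar>a (k - 1) * a k - b (k - 1) * b k\<bar>"
      using assms(1,2) by (simp add: abs_mult u_def v_def w_def)
    also have "\<dots> \<le> q ^ n * (\<nu> * d) + q ^ n * (2 * R * d) + q ^ n * (2 * R * d)"
    proof -
      have "q ^ i * z \<le> q ^ n * z'" if "0 < q ^ i" "q ^ i \<le> q ^ n" "0 \<le> z" "z \<le> z'" for i z z'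
        using that by (intro mult_mono) auto
      moreover have "\<nu> * \<bar>a k - b k\<bar> \<le> \<nu> * d" "0 \<le> \<nu> * \<bar>a k - b k\<bar>"
        using assms(1) ab by auto
      ultimately show ?thesis
        using qk prod by (intro add_mono) auto
    qed
    finally show ?thesis by (simp add: algebra_simps)
  qed
qed

instance bcontfun :: (metric_space, banach) banach ..

lemma bounded_linear_apply_bcontfun:
  "bounded_linear (\<lambda>x :: 'a::topological_space \<Rightarrow>\<^sub>C 'b::real_normed_vector. apply_bcontfun x a)"
  by (rule bounded_linear_intro[where K = 1]) (use norm_bounded in auto)

text \<open>The trajectory stays where clipping is inactive. A negative coordinate is clipped to 0,
  which leaves only the nonnegative source in its equation; the upper bound comes from an energy
  adapted to the clipping.\<close>

lemma clipped_flow_invariant: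
  fixes x :: "real \<Rightarrow> nat \<Rightarrow> real"
  assumes nu: "\<nu> > 0" and q: "q > 1" and R: "R > 0" and A: "0 \<le> A" "A \<le> R" and n: "n \<ge> 1"
    and init: "\<And>k. x 0 k = (if k = n then A else 0)"
    and der: "\<And>t k. t \<ge> 0 \<Longrightarrow>
      ((\<lambda>u. x u k) has_real_derivative clipped_field \<nu> q n R (x t) k) (at t within {0..})"
  shows "truncated_dyadic \<nu> q n x"
proof -
  have nonneg: "x t k \<ge> 0" if t: "t \<ge> 0" for t k
  proof -
    have "(max 0 (- x t k))\<^sup>2 \<le> (max 0 (- x 0 k))\<^sup>2"
    proof (rule deriv_nonpos_imp_le[OF t, where S = "{0..}"])
      fix u assume "u \<in> {0..t}"
      then have u: "u \<ge> 0" by simp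
      show "((\<lambda>u. (max 0 (- x u k))\<^sup>2) has_real_derivative
          2 * max 0 (- x u k) * (- clipped_field \<nu> q n R (x u) k)) (at u within {0..})"
        by (rule DERIV_chain2[OF has_real_derivative_positive_part_square DERIV_minus[OF der[OF u]]])
      show "2 * max 0 (- x u k) * (- clipped_field \<nu> q n R (x u) k) \<le> 0"
      proof (cases "x u k < 0")
        case True
        then have "clip_modes n R (x u) k = 0" by (simp add: clip_modes_def clip_def)
        then have "clipped_field \<nu> q n R (x u) k \<ge> 0"
          using q by (simp add: clipped_field_def dyadic_rhs_def)
        then show ?thesis by (intro mult_nonneg_nonpos) auto
      qed auto
    qed auto
    then have "max 0 (- x t k) = 0" using A by (auto simp: init split: if_splits)
    then show ?thesis by linarith
  qed
  have outside: "x t k = 0" if t: "t \<ge> 0" and k: "k = 0 \<or> n < k" for t k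
  proof -
    have c: "clipped_field \<nu> q n R y k = 0" for y
      using k by (auto simp: clipped_field_def dyadic_rhs_def clip_modes_def)
    have "x t k \<le> x 0 k"
      by (rule deriv_nonpos_imp_le[OF t _ der]) (use c in auto)
    then show ?thesis using nonneg[OF t, of k] k n by (auto simp: init)
  qed
  have le: "x t k \<le> R" if t: "t \<ge> 0" for t k
  proof (cases "1 \<le> k \<and> k \<le> n")
    case True
    \<comment> \<open>The square up to \<open>R\<close>, continued linearly beyond, so that for
      \<open>y \<ge> 0\<close> the derivative is twice the clipped value. The sum over the modes
      then dissipates like the energy, by \<open>sum_dyadic_rhs\<close> for the clipped
      sequence.\<close>
    define \<psi> where "\<psi> y = y\<^sup>2 - (max 0 (y - R))\<^sup>2" for y
    have psi0: "\<psi> y \<ge> 0" if "y \<ge> 0" for y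
      using that R unfolding \<psi>_def by (simp add: power_mono)
    have "(\<Sum>k=1..n. \<psi> (x t k)) \<le> (\<Sum>k=1..n. \<psi> (x 0 k))"
    proof (rule deriv_nonpos_imp_le[OF t, where S = "{0..}"])
      fix u assume "u \<in> {0..t}"
      then have u: "u \<ge> 0" by simp
      let ?c = "clip_modes n R (x u)"
      have "((\<lambda>u. \<psi> (x u k)) has_real_derivative 2 * ?c k * dyadic_rhs \<nu> q ?c k) (at u within {0..})"
        if "k \<in> {1..n}" for k
      proof -
        have c: "?c k = x u k - max 0 (x u k - R)"
          using that nonneg[OF u, of k] R by (auto simp: clip_modes_def clip_def)
        have d: "((\<lambda>u. x u k) has_real_derivative dyadic_rhs \<nu> q ?c k) (at u within {0..})"
          using der[OF u, of k] that by (simp add: clipped_field_def)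
        then have d': "((\<lambda>u. x u k - R) has_real_derivative dyadic_rhs \<nu> q ?c k) (at u within {0..})"
          by (auto intro!: derivative_eq_intros)
        show ?thesis
          unfolding \<psi>_def c
          by (rule DERIV_cong[OF DERIV_diff[OF DERIV_power[OF d]
                 DERIV_chain2[OF has_real_derivative_positive_part_square d']]])
             (simp add: c algebra_simps)
      qed
      then show "((\<lambda>u. \<Sum>k=1..n. \<psi> (x u k)) has_real_derivative (\<Sum>k=1..n. 2 * ?c k * dyadic_rhs \<nu> q ?c k))
          (at u within {0..})"
        by (rule DERIV_sum)
      have "(\<Sum>k=1..n. 2 * ?c k * dyadic_rhs \<nu> q ?c k) = - 2 * \<nu> * (\<Sum>k=1..n. q ^ k * (?c k)\<^sup>2)"
        by (subst sum_dyadic_rhs) (auto simp: clip_modes_def)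
      also have "\<dots> \<le> 0"
        using nu q by (intro mult_nonpos_nonneg sum_nonneg) auto
      finally show "(\<Sum>k=1..n. 2 * ?c k * dyadic_rhs \<nu> q ?c k) \<le> 0" .
    qed auto
    also have "(\<Sum>k=1..n. \<psi> (x 0 k)) = (\<Sum>k\<in>{n}. \<psi> (x 0 k))"
      using n R by (intro sum.mono_neutral_right) (auto simp: init \<psi>_def)
    also have "\<dots> \<le> R\<^sup>2"
      using A by (simp add: init \<psi>_def power_mono)
    finally have "\<psi> (x t k) \<le> R\<^sup>2"
      using member_le_sum[of k "{1..n}" "\<lambda>k. \<psi> (x t k)"] True psi0 nonneg[OF t] by fastforce
    show ?thesis
    proof (rule ccontr)
      assume c: "\<not> x t k \<le> R"
      then have "\<psi> (x t k) = R\<^sup>2 + 2 * R * (x t k - R)"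
        by (simp add: \<psi>_def power2_eq_square algebra_simps)
      moreover have "2 * R * (x t k - R) > 0" using c R by simp
      ultimately show False using \<open>\<psi> (x t k) \<le> R\<^sup>2\<close> by linarith
    qed
  next
    case False
    then have "k = 0 \<or> n < k" by auto
    then show ?thesis using outside[OF t] R by simp
  qed
  have unclip: "clip_modes n R (x t) = x t" if t: "t \<ge> 0" for t
  proof
    fix k
    show "clip_modes n R (x t) k = x t k"
      using nonneg[OF t, of k] le[OF t, of k] outside[OF t, of k]
      by (cases "1 \<le> k \<and> k \<le> n") (auto simp: clip_modes_def clip_def)
  qed
  show ?thesis
  proof
    show "((\<lambda>u. x u k) has_real_derivative dyadic_rhs \<nu> q (x t) k) (at t within {0..})"
      if "t \<ge> 0" "k \<ge> 1" for t k
      using der[OF that(1), of k] that(2) unclip[OF that(1)] by (simp add: clipped_field_def)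
  qed (use nu q nonneg outside in auto)
qed

text \<open>The phase space consists of the bounded sequences with the sup norm, realized as bounded
  continuous functions on the discrete naturals. One flow on it serves all amplitudes
  \<open>A\<close> and depends on \<open>A\<close> in a Lipschitz way, as the later choice of
  amplitude requires.\<close>

lemma truncated_family:
  assumes nu: "\<nu> > 0" and q: "q > 1" and R: "R > 0" and n: "n \<ge> 1"
  obtains X :: "real \<Rightarrow> real \<Rightarrow> nat \<Rightarrow> real" and L
  where "\<And>A. 0 \<le> A \<Longrightarrow> A \<le> R \<Longrightarrow> truncated_dyadic \<nu> q n (X A)"
    and "\<And>A k. X A 0 k = (if k = n then A else 0)"
    and "\<And>A A' t k. t \<ge> 0 \<Longrightarrow> \<bar>X A t k - X A' t k\<bar> \<le> 2 * exp (2 * L * t) * \<bar>A - A'\<bar>"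
    and "L > 0"
proof -
  define L where "L = q ^ n * (\<nu> + 4 * R)"
  have L: "L > 0" unfolding L_def using nu q R by (intro mult_pos_pos) auto
  define ev where "ev x k = apply_bcontfun x (discrete k)" for x :: "nat discrete \<Rightarrow>\<^sub>C real" and k
  have ev_diff: "ev (x - y) k = ev x k - ev y k" and ev_0: "ev 0 = (\<lambda>_. 0)" for x y k
    by (simp_all add: ev_def fun_eq_iff)
  have ev_norm: "\<bar>ev x k\<bar> \<le> norm x" for x k
    using norm_bounded[of x "discrete k"] by (simp add: ev_def)
  have cont: "continuous_on UNIV g" for g :: "nat discrete \<Rightarrow> real"
    by (simp add: continuous_on_open_vimage open_discrete)
  have ev_bound: "norm x \<le> b" if "\<And>k. \<bar>ev x k\<bar> \<le> b" for x b
  proof (rule norm_bound)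
    fix j show "norm (apply_bcontfun x j) \<le> b"
      using that[of "of_discrete j"] by (simp add: ev_def of_discrete_inverse)
  qed
  define f where "f x = Bcontfun (\<lambda>j. clipped_field \<nu> q n R (ev x) (of_discrete j))" for x
  have zero: "clipped_field \<nu> q n R (\<lambda>_. 0) k = 0" for k
    using R by (simp add: clipped_field_def dyadic_rhs_def clip_modes_def clip_def)
  have lip: "\<bar>clipped_field \<nu> q n R (ev x) k - clipped_field \<nu> q n R (ev y) k\<bar> \<le> L * norm (x - y)" for x y k
    unfolding L_def using ev_norm[of "x - y"] R
    by (intro clipped_field_lipschitz nu q) (auto simp: ev_diff)
  have f: "ev (f x) = clipped_field \<nu> q n R (ev x)" for x
  proof -
    have "norm (clipped_field \<nu> q n R (ev x) (of_discrete j)) \<le> L * norm x" for j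
      using lip[of x "of_discrete j" 0] by (simp add: ev_0 zero)
    then have "apply_bcontfun (f x) = (\<lambda>j. clipped_field \<nu> q n R (ev x) (of_discrete j))"
      unfolding f_def by (intro Bcontfun_inverse bcontfun_normI cont)
    then show ?thesis by (simp add: ev_def fun_eq_iff discrete_inverse)
  qed
  have flip: "norm (f x - f y) \<le> L * norm (x - y)" for x y
    by (rule ev_bound) (use lip in \<open>simp add: f ev_diff\<close>)
  have f0: "f 0 = 0"
    using ev_bound[of "f 0" 0] by (simp add: f ev_0 zero)
  obtain \<phi> where \<phi>: "\<And>x. \<phi> x 0 = x"
    "\<And>x t. t \<ge> 0 \<Longrightarrow> (\<phi> x has_vector_derivative f (\<phi> x t)) (at t within {0..})"
    "\<And>x y t. t \<ge> 0 \<Longrightarrow> norm (\<phi> x t - \<phi> y t) \<le> 2 * exp (2 * L * t) * norm (x - y)"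
    using lipschitz_flow_exists[OF L flip f0] by metis
  define e where "e A = Bcontfun (\<lambda>j. if of_discrete j = n then A else 0 :: real)" for A
  have "apply_bcontfun (e A) = (\<lambda>j. if of_discrete j = n then A else 0)" for A
    unfolding e_def by (intro Bcontfun_inverse bcontfun_normI[where b = "\<bar>A\<bar>"] cont) auto
  then have e: "ev (e A) = (\<lambda>k. if k = n then A else 0)" for A
    by (simp add: ev_def fun_eq_iff discrete_inverse)
  have ediff: "norm (e A - e A') \<le> \<bar>A - A'\<bar>" for A A'
    by (rule ev_bound) (simp add: ev_diff e)
  define X where "X A t = ev (\<phi> (e A) t)" for A t
  have init: "X A 0 k = (if k = n then A else 0)" for A k
    by (simp add: X_def \<phi> e)
  show ?thesis
  proof (rule that[of X L])
    show "truncated_dyadic \<nu> q n (X A)" if "0 \<le> A" "A \<le> R" for A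
    proof (rule clipped_flow_invariant[where x = "X A", OF nu q R that n init])
      fix t :: real and k assume "t \<ge> 0"
      from bounded_linear.has_vector_derivative[OF bounded_linear_apply_bcontfun \<phi>(2)[OF this, of "e A"], of "discrete k"]
      show "((\<lambda>u. X A u k) has_real_derivative clipped_field \<nu> q n R (X A t) k) (at t within {0..})"
        by (simp add: X_def has_real_derivative_iff_has_vector_derivative flip: ev_def f)
    qed
    show "\<bar>X A t k - X A' t k\<bar> \<le> 2 * exp (2 * L * t) * \<bar>A - A'\<bar>" if "t \<ge> 0" for A A' t k
    proof -
      have "\<bar>X A t k - X A' t k\<bar> \<le> norm (\<phi> (e A) t - \<phi> (e A') t)"
        using ev_norm[of "\<phi> (e A) t - \<phi> (e A') t" k] by (simp add: X_def ev_diff)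
      also have "\<dots> \<le> 2 * exp (2 * L * t) * norm (e A - e A')" by (rule \<phi>(3)[OF that])
      also have "\<dots> \<le> 2 * exp (2 * L * t) * \<bar>A - A'\<bar>" by (intro mult_left_mono ediff) auto
      finally show ?thesis .
    qed
  qed (use init L in auto)
qed

text \<open>The time of the maximum may jump with \<open>A\<close>, but the maximal value inherits
  the Lipschitz bound, so the intermediate value theorem applies to it.\<close>

lemma max_value_intermediate:
  fixes x :: "real \<Rightarrow> real \<Rightarrow> real"
  assumes "T \<ge> 0" and "R \<ge> 0"
    and cont: "\<And>A. A \<in> {0..R} \<Longrightarrow> continuous_on {0..T} (x A)"
    and lip: "\<And>A A' t. A \<in> {0..R} \<Longrightarrow> A' \<in> {0..R} \<Longrightarrow> t \<in> {0..T} \<Longrightarrow> \<bar>x A t - x A' t\<bar> \<le> C * \<bar>A - A'\<bar>"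
    and lo: "\<And>t. t \<in> {0..T} \<Longrightarrow> x 0 t \<le> y" and hi: "\<exists>t\<in>{0..T}. x R t \<ge> y"
  obtains A t where "A \<in> {0..R}" "t \<in> {0..T}" "x A t = y" "\<And>s. s \<in> {0..T} \<Longrightarrow> x A s \<le> y"
proof -
  have "\<exists>t\<in>{0..T}. \<forall>s\<in>{0..T}. x A s \<le> x A t" if "A \<in> {0..R}" for A
    by (rule continuous_attains_sup) (use assms cont that in auto)
  then obtain m where m: "\<And>A. A \<in> {0..R} \<Longrightarrow> m A \<in> {0..T}"
    "\<And>A s. A \<in> {0..R} \<Longrightarrow> s \<in> {0..T} \<Longrightarrow> x A s \<le> x A (m A)" by metis
  define g where "g A = x A (m A)" for A
  have half: "g A - g A' \<le> C * \<bar>A - A'\<bar>" if "A \<in> {0..R}" "A' \<in> {0..R}" for A A'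
    using lip[OF that m(1)[OF that(1)]] m(2)[OF that(2) m(1)[OF that(1)]] by (simp add: g_def)
  have "\<bar>g A - g A'\<bar> \<le> \<bar>C\<bar> * \<bar>A - A'\<bar>" if "A \<in> {0..R}" "A' \<in> {0..R}" for A A'
  proof -
    have "C * \<bar>A - A'\<bar> \<le> \<bar>C\<bar> * \<bar>A - A'\<bar>" by (intro mult_right_mono) auto
    then show ?thesis
      using half[OF that] half[OF that(2,1)] by (simp add: abs_minus_commute abs_le_iff)
  qed
  then have "\<bar>C\<bar>-lipschitz_on {0..R} g"
    by (intro lipschitz_onI) (auto simp: dist_real_def)
  then have "continuous_on {0..R} g" by (rule lipschitz_on_continuous_on)
  moreover have "g 0 \<le> y" "y \<le> g R"
    using lo m hi \<open>R \<ge> 0\<close> unfolding g_def by (auto intro: order_trans)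
  ultimately obtain A where "0 \<le> A" "A \<le> R" "g A = y"
    using IVT'[of g 0 y R] \<open>R \<ge> 0\<close> by auto
  then show ?thesis
    using that[of A "m A"] m[of A] by (auto simp: g_def)
qed

lemma normalized_truncated_solution:
  assumes nu: "\<nu> > 0" and q: "q > 1" and n: "n \<ge> 1"
  obtains X T where "truncated_dyadic \<nu> q n X" and "\<And>k. k < n \<Longrightarrow> X 0 k = 0"
    and "T \<ge> 0" and "X T 1 = 1" and "\<And>t. t \<ge> 0 \<Longrightarrow> X t 1 \<le> 1"
proof -
  \<comment> \<open>One more than the bound of \<open>growth\<close> for mode \<open>n\<close>, so
    that amplitude \<open>R\<close> forces mode 1 above 1 at some time.\<close>
  define R where "R = (1 + \<nu> * q) * 2 ^ n + 1"
  have R: "R \<ge> 1" using nu q by (simp add: R_def)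
  then have R0: "R > 0" by simp
  obtain X L where X: "\<And>A. 0 \<le> A \<Longrightarrow> A \<le> R \<Longrightarrow> truncated_dyadic \<nu> q n (X A)"
    and init: "\<And>A k. X A 0 k = (if k = n then A else 0)"
    and lip: "\<And>A A' t k. t \<ge> 0 \<Longrightarrow> \<bar>X A t k - X A' t k\<bar> \<le> 2 * exp (2 * L * t) * \<bar>A - A'\<bar>"
    and L: "L > 0"
    using truncated_family[OF nu q R0 n] by metis
  have decay: "(X A t 1)\<^sup>2 \<le> A\<^sup>2 * exp (- (2 * \<nu> * q) * t)" if "0 \<le> A" "A \<le> R" "t \<ge> 0" for A t
  proof -
    interpret truncated_dyadic \<nu> q n "X A" by (rule X[OF that(1,2)])
    have "energy 1 0 = (\<Sum>k\<in>{n}. (X A 0 k)\<^sup>2)"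
      unfolding energy_def using n by (intro sum.mono_neutral_right) (auto simp: init)
    then show ?thesis
      using X_le_energy[OF that(3), of 1 1] energy_decay[OF order_refl that(3), of 1] by (simp add: init)
  qed
  \<comment> \<open>From \<open>T\<close> on, dissipation alone keeps mode 1 at most 1 for every
    amplitude up to \<open>R\<close>, so it suffices to control the maximum over
    \<open>{0..T}\<close>.\<close>
  define T where "T = ln R / (\<nu> * q)"
  have T: "T \<ge> 0" using R nu q by (simp add: T_def)
  have late: "X A t 1 \<le> 1" if "0 \<le> A" "A \<le> R" "t \<ge> T" for A t
  proof -
    have "\<nu> * q * t \<ge> \<nu> * q * T" using that nu q by (intro mult_left_mono) auto
    then have "exp (- (2 * \<nu> * q) * t) \<le> exp (- 2 * ln R)"
      using nu q by (simp add: T_def)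
    then have "A\<^sup>2 * exp (- (2 * \<nu> * q) * t) \<le> R\<^sup>2 * exp (- 2 * ln R)"
      using that by (intro mult_mono power_mono) auto
    also have "exp (- 2 * ln R) = 1 / R\<^sup>2"
      using R exp_of_nat_mult[of 2 "ln R"] by (simp add: exp_minus divide_inverse)
    finally have "(X A t 1)\<^sup>2 \<le> 1\<^sup>2"
      using decay[of A t] that T R by simp
    then show ?thesis by (rule power2_le_imp_le) simp
  qed
  have high: "\<exists>t\<in>{0..T}. X R t 1 \<ge> 1"
  proof (rule ccontr)
    interpret truncated_dyadic \<nu> q n "X R" using X[of R] R by simp
    assume "\<not> ?thesis"
    then have "X R t 1 \<le> 1" if "t \<ge> 0" for t
      using late[of R t] R that by (cases "t \<le> T") force+
    then have "X R 0 n \<le> (1 + \<nu> * q) * 2 ^ n" by (rule growth) auto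
    then show False by (simp add: init R_def)
  qed
  obtain A t where A: "A \<in> {0..R}" "t \<in> {0..T}" "X A t 1 = 1" "\<And>s. s \<in> {0..T} \<Longrightarrow> X A s 1 \<le> 1"
  proof (rule max_value_intermediate[where x = "\<lambda>A t. X A t 1" and T = T and R = R and y = 1
        and C = "2 * exp (2 * L * T)"])
    show "continuous_on {0..T} (\<lambda>t. X A t 1)" if "A \<in> {0..R}" for A
    proof -
      interpret truncated_dyadic \<nu> q n "X A" using X that by simp
      have "continuous_on {0..} (\<lambda>t. X A t 1)"
        unfolding continuous_on_eq_continuous_within using DERIV_continuous[OF deriv] by simp
      then show ?thesis by (rule continuous_on_subset) auto
    qed
    show "\<bar>X A t 1 - X A' t 1\<bar> \<le> 2 * exp (2 * L * T) * \<bar>A - A'\<bar>" if "t \<in> {0..T}" for A A' t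
    proof (rule order_trans[OF lip])
      show "2 * exp (2 * L * t) * \<bar>A - A'\<bar> \<le> 2 * exp (2 * L * T) * \<bar>A - A'\<bar>"
        using that L by (intro mult_right_mono) auto
    qed (use that in auto)
    show "X 0 t 1 \<le> 1" if "t \<in> {0..T}" for t
      using decay[of 0 t] that R by simp
  qed (use T R high in auto)
  show ?thesis
  proof (rule that)
    show "truncated_dyadic \<nu> q n (X A)" using X A by simp
    show "X A t 1 = 1" by fact
    show "X A s 1 \<le> 1" if "s \<ge> 0" for s
      using late[of A s] A that by (cases "s \<le> T") auto
  qed (use A init in auto)
qed

section \<open>The limit of infinitely many modes\<close>

text \<open>Moving from \<open>t\<close> to a nearby rational time changes every \<open>g n\<close>
  by less than a third of the tolerance, uniformly in \<open>n\<close>.\<close>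

lemma equilipschitz_convergent:
  fixes g :: "nat \<Rightarrow> real \<Rightarrow> real"
  assumes lip: "\<And>n s t. s \<ge> 0 \<Longrightarrow> t \<ge> 0 \<Longrightarrow> \<bar>g n s - g n t\<bar> \<le> L * \<bar>s - t\<bar>"
    and conv: "\<And>p. p \<in> \<rat> \<Longrightarrow> p \<ge> 0 \<Longrightarrow> convergent (\<lambda>n. g n p)" and t: "t \<ge> 0"
  shows "convergent (\<lambda>n. g n t)"
proof (rule real_Cauchy_convergent, rule metric_CauchyI)
  fix e :: real assume e: "e > 0"
  define L' where "L' = max 1 L"
  have L': "L' > 0" "L \<le> L'" by (auto simp: L'_def)
  have lip': "\<bar>g n s - g n t\<bar> \<le> L' * \<bar>s - t\<bar>" if "s \<ge> 0" for n s
    using lip[OF that t, of n] mult_right_mono[OF L'(2), of "\<bar>s - t\<bar>"] by linarith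
  obtain p where p: "p \<in> \<rat>" "t < p" "p < t + e / (3 * L')"
    using Rats_dense_in_real[of t "t + e / (3 * L')"] e L' by auto
  then have small: "\<bar>g n p - g n t\<bar> < e / 3" for n
    using lip'[of p n] t L' by (simp add: field_simps)
  have "Cauchy (\<lambda>n. g n p)"
    using conv[of p] p t by (intro convergent_Cauchy) auto
  then obtain M where M: "\<And>m n. m \<ge> M \<Longrightarrow> n \<ge> M \<Longrightarrow> dist (g m p) (g n p) < e / 3"
    using e unfolding Cauchy_def by (metis divide_pos_pos zero_less_numeral)
  then have "dist (g m t) (g n t) < e" if "m \<ge> M" "n \<ge> M" for m n
    using M[OF that] small[of m] small[of n] unfolding dist_real_def by linarith
  then show "\<exists>M. \<forall>m\<ge>M. \<forall>n\<ge>M. dist (g m t) (g n t) < e" by blast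
qed

context truncated_dyadic
begin

text \<open>The bound is independent of time and of \<open>n\<close>: it yields equicontinuity of
  the truncations and a majorant for the limit of the integrals.\<close>

lemma abs_rhs_le:
  assumes B: "\<And>t k. t \<ge> 0 \<Longrightarrow> X t k \<le> B * 2 ^ k" and u: "u \<ge> 0"
  shows "\<bar>dyadic_rhs \<nu> q (X u) k\<bar> \<le>
    \<nu> * q ^ k * (B * 2 ^ k) + q ^ k * (B * 2 ^ (k + 1))\<^sup>2 + q ^ (k - 1) * (B * 2 ^ k)\<^sup>2"
proof -
  have b: "0 \<le> X u j" "X u j \<le> B * 2 ^ j" for j using B[OF u] nonneg[OF u] by auto
  have B0: "B \<ge> 0" using order_trans[OF b, of 0] by simp
  have k1: "X u (k - 1) \<le> B * 2 ^ k"
  proof -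
    have "B * 2 ^ (k - 1) \<le> B * 2 ^ k"
      using B0 by (intro mult_left_mono power_increasing) auto
    then show ?thesis using b[of "k - 1"] by linarith
  qed
  have "0 \<le> \<nu> * q ^ k * X u k" "\<nu> * q ^ k * X u k \<le> \<nu> * q ^ k * (B * 2 ^ k)"
    using b nu_pos q_gt_1 by (auto intro!: mult_left_mono)
  moreover have "0 \<le> q ^ k * (X u (k + 1))\<^sup>2" "q ^ k * (X u (k + 1))\<^sup>2 \<le> q ^ k * (B * 2 ^ (k + 1))\<^sup>2"
    using b[of "k + 1"] q_gt_1 by (auto intro!: mult_left_mono power_mono)
  moreover have "0 \<le> q ^ (k - 1) * X u (k - 1) * X u k"
    using b q_gt_1 by auto
  moreover have "q ^ (k - 1) * X u (k - 1) * X u k \<le> q ^ (k - 1) * (B * 2 ^ k)\<^sup>2"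
  proof -
    have "X u (k - 1) * X u k \<le> (B * 2 ^ k) * (B * 2 ^ k)"
      using k1 b B0 by (intro mult_mono) auto
    then show ?thesis
      unfolding power2_eq_square mult.assoc[of "q ^ (k - 1)"] using q_gt_1 by (intro mult_left_mono) auto
  qed
  ultimately show ?thesis unfolding dyadic_rhs_def by (simp only: abs_le_iff) linarith
qed

lemma lipschitz_in_time:
  assumes B: "\<And>t k. t \<ge> 0 \<Longrightarrow> X t k \<le> B * 2 ^ k" and s: "s \<ge> 0" and t: "t \<ge> 0"
  shows "\<bar>X s k - X t k\<bar> \<le>
    (\<nu> * q ^ k * (B * 2 ^ k) + q ^ k * (B * 2 ^ (k + 1))\<^sup>2 + q ^ (k - 1) * (B * 2 ^ k)\<^sup>2) * \<bar>s - t\<bar>"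
    (is "_ \<le> ?L * _")
proof (cases "k = 0")
  case True
  have "?L \<ge> 0"
    using abs_rhs_le[OF B s, of k] by linarith
  then show ?thesis using X_0 s t True by simp
next
  case False
  have "norm (X s k - X t k) \<le> ?L * norm (s - t)"
    by (rule field_differentiable_bound[where S = "{0..}" and f' = "\<lambda>u. dyadic_rhs \<nu> q (X u) k"])
       (use abs_rhs_le[OF B] deriv False s t in auto)
  then show ?thesis by simp
qed

lemma energy_eq_suminf: "t \<ge> 0 \<Longrightarrow> energy 1 t = (\<Sum>k. (X t (Suc k))\<^sup>2)"
  unfolding energy_def One_nat_def sum.atLeast1_atMost_eq
  by (rule suminf_finite[symmetric]) (auto simp: X_beyond)

lemma has_integral_rhs:
  assumes "t \<ge> 0" and "k \<ge> 1"
  shows "((\<lambda>s. dyadic_rhs \<nu> q (X s) k) has_integral X t k - X 0 k) {0..t}"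
proof (rule fundamental_theorem_of_calculus[OF assms(1)])
  fix x assume "x \<in> {0..t}"
  then have "((\<lambda>s. X s k) has_real_derivative dyadic_rhs \<nu> q (X x) k) (at x within {0..t})"
    by (intro DERIV_subset[OF deriv] assms(2)) auto
  then show "((\<lambda>s. X s k) has_vector_derivative dyadic_rhs \<nu> q (X x) k) (at x within {0..t})"
    by (simp add: has_real_derivative_iff_has_vector_derivative)
qed

end

text \<open>The exponential still beats one additional power of \<open>a ^ Suc k\<close>, which
  leaves a geometric majorant with ratio \<open>1 / a\<close>.\<close>

lemma summable_powr_exp:
  fixes a c r :: real
  assumes "a > 1" and "c > 0" and "m \<ge> 1"
  shows "summable (\<lambda>k. (a ^ Suc k) powr r * exp (- c * (a ^ Suc k) ^ m))"
proof (rule summable_comparison_test_ev)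
  have "((\<lambda>x. x powr (r + 1) * exp (- c * x ^ m)) \<longlongrightarrow> 0) at_top"
  proof (rule tendsto_sandwich[where f = "\<lambda>_. 0" and h = "\<lambda>x. x powr (r + 1) * exp (- c * x)"])
    show "\<forall>\<^sub>F x in at_top. x powr (r + 1) * exp (- c * x ^ m) \<le> x powr (r + 1) * exp (- c * x)"
      using eventually_ge_at_top[of 1]
    proof eventually_elim
      case (elim x)
      then have "x \<le> x ^ m" using assms by (intro self_le_power) auto
      then show ?case using assms by (intro mult_left_mono) auto
    qed
    show "((\<lambda>x. x powr (r + 1) * exp (- c * x)) \<longlongrightarrow> 0) at_top"
      using assms by real_asymp
  qed auto
  then have "eventually (\<lambda>x. x powr (r + 1) * exp (- c * x ^ m) < 1) at_top"
    by (rule order_tendstoD) simp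
  moreover have "filterlim (\<lambda>k. a ^ Suc k) at_top sequentially"
    using assms(1) by real_asymp
  ultimately have "eventually (\<lambda>k. (a ^ Suc k) powr (r + 1) * exp (- c * (a ^ Suc k) ^ m) < 1) sequentially"
    by (rule eventually_compose_filterlim)
  then show "eventually (\<lambda>k. norm ((a ^ Suc k) powr r * exp (- c * (a ^ Suc k) ^ m)) \<le> (1 / a) ^ Suc k) sequentially"
  proof eventually_elim
    case (elim k)
    have "a ^ Suc k > 0" using assms(1) by simp
    then show ?case using elim
      by (simp add: powr_add field_simps del: power_Suc)
  qed
  show "summable (\<lambda>k. (1 / a) ^ Suc k)"
    using assms(1) by (simp only: summable_Suc_iff) (intro summable_geometric, simp)
qed

text \<open>Limit of the normalized truncations, along a subsequence that converges in every mode at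
  rational times and for which the times \<open>S n\<close>, where mode 1 equals 1, converge too.
  The initial data disappear because they sit in mode \<open>Suc n\<close> alone.\<close>

lemma cascade_from_infinity:
  assumes nu: "\<nu> > 0" and q: "q > 1"
  obtains X :: "real \<Rightarrow> nat \<Rightarrow> real" and T :: real
  where "\<And>t k. t \<ge> 0 \<Longrightarrow> 0 \<le> X t k" and "\<And>t. t \<ge> 0 \<Longrightarrow> X t 0 = 0" and "\<And>k. X 0 k = 0"
    and "\<And>t k. t \<ge> 0 \<Longrightarrow> k \<ge> 1 \<Longrightarrow>
      ((\<lambda>u. X u k) has_real_derivative dyadic_rhs \<nu> q (X t) k) (at t within {0..})"
    and "\<And>t k. t \<ge> 0 \<Longrightarrow> X t k \<le> (1 + \<nu> * q) * 2 ^ k"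
    and "\<And>d. d > 0 \<Longrightarrow> \<exists>C>0. \<forall>t\<ge>d. \<forall>k\<ge>1. (X t k)\<^sup>2 \<le> C * exp (- \<nu> * q ^ k * t)"
    and "T \<ge> 0" and "X T 1 = 1"
    and "\<And>t K. t > 0 \<Longrightarrow> K \<ge> 1 \<Longrightarrow> 8 * (1 + \<nu> * q)\<^sup>2 * t * (8 * q) ^ K \<le> 1 \<Longrightarrow>
      \<nu> * q / 2 * real K \<le> l2_norm (X t) ^ 3"
proof -
  define B where "B = 1 + \<nu> * q"
  have B: "B \<ge> 1" using nu q by (simp add: B_def)
  have "\<exists>X T. truncated_dyadic \<nu> q (Suc n) X \<and> (\<forall>k<Suc n. X 0 k = 0) \<and>
      T \<ge> 0 \<and> X T 1 = 1 \<and> (\<forall>t\<ge>0. X t 1 \<le> 1)" for n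
  proof -
    obtain X T where "truncated_dyadic \<nu> q (Suc n) X" and "\<And>k. k < Suc n \<Longrightarrow> X 0 k = 0"
      and "T \<ge> 0" and "X T 1 = 1" and "\<And>t. t \<ge> 0 \<Longrightarrow> X t 1 \<le> 1"
      using normalized_truncated_solution[OF nu q, of "Suc n"] by auto
    then show ?thesis by blast
  qed
  then obtain Y S where Y: "\<And>n. truncated_dyadic \<nu> q (Suc n) (Y n)"
    and Y0: "\<And>n k. k < Suc n \<Longrightarrow> Y n 0 k = 0"
    and S: "\<And>n. S n \<ge> 0" "\<And>n. Y n (S n) 1 = 1" and Y1: "\<And>n t. t \<ge> 0 \<Longrightarrow> Y n t 1 \<le> 1"
    by metis
  have YB: "Y n t k \<le> B * 2 ^ k" if "t \<ge> 0" for n t k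
    unfolding B_def using Y1 that by (intro truncated_dyadic.growth[OF Y]) auto
  have Y_nonneg: "Y n t k \<ge> 0" if "t \<ge> 0" for n t k
    using truncated_dyadic.nonneg[OF Y that] .
  define L where "L k = \<nu> * q ^ k * (B * 2 ^ k) + q ^ k * (B * 2 ^ (k + 1))\<^sup>2 + q ^ (k - 1) * (B * 2 ^ k)\<^sup>2" for k
  have Ylip: "\<bar>Y n s k - Y n t k\<bar> \<le> L k * \<bar>s - t\<bar>" if "s \<ge> 0" "t \<ge> 0" for n s t k
    unfolding L_def using that by (intro truncated_dyadic.lipschitz_in_time[OF Y] YB) auto
  have smooth: "\<exists>C>0. \<forall>n. \<forall>t\<ge>d. \<forall>k\<ge>1. (Y n t k)\<^sup>2 \<le> C * exp (- \<nu> * q ^ k * t)" if "d > 0" for d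
  proof -
    obtain C where "C > 0" "\<And>n X t k. truncated_dyadic \<nu> q n X \<Longrightarrow> (\<And>t k. t \<ge> 0 \<Longrightarrow> X t k \<le> B * 2 ^ k) \<Longrightarrow>
        t \<ge> d \<Longrightarrow> k \<ge> 1 \<Longrightarrow> (X t k)\<^sup>2 \<le> C * exp (- \<nu> * q ^ k * t)"
      using smoothing_bound[OF nu q B \<open>d > 0\<close>] by metis
    then show ?thesis using Y YB by blast
  qed
  obtain C where C: "C > 0" "\<And>n t k. t \<ge> 1 \<Longrightarrow> k \<ge> 1 \<Longrightarrow> (Y n t k)\<^sup>2 \<le> C * exp (- \<nu> * q ^ k * t)"
    using smooth[of 1] by auto
  \<comment> \<open>Smoothing after time 1 gives \<open>1 \<le> C * exp (- \<nu> * q * S n)\<close>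
    whenever \<open>S n \<ge> 1\<close>, so the times \<open>S n\<close> cannot run off to
    infinity.\<close>
  define M where "M = max 1 (ln C / (\<nu> * q))"
  have "S n \<in> {0..M}" for n
  proof -
    have "S n \<le> ln C / (\<nu> * q)" if "S n \<ge> 1"
    proof -
      have "1 \<le> C * exp (- \<nu> * q * S n)"
        using C(2)[OF that, of 1 n] S(2) by simp
      then have "exp (\<nu> * q * S n) \<le> C"
        by (simp add: exp_minus field_simps)
      then have "\<nu> * q * S n \<le> ln C"
        using C(1) by (simp add: ln_ge_iff)
      then show ?thesis using nu q by (simp add: field_simps)
    qed
    then show ?thesis using S(1)[of n] by (cases "S n \<ge> 1") (auto simp: M_def)
  qed
  then obtain T r1 where T: "T \<in> {0..M}" and r1: "strict_mono r1" "(S \<circ> r1) \<longlonglongrightarrow> T"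
    using compact_Icc[of 0 M] unfolding compact_eq_seq_compact_metric seq_compact_def by metis
  define Q where "Q = (\<rat> \<inter> {0 :: real..}) \<times> (UNIV :: nat set)"
  have Q: "countable Q" unfolding Q_def by (intro countable_SIGMA countable_Int1 countable_rat) auto
  \<comment> \<open>Division by the growth bound gives the diagonal argument one bound for all pairs
    of time and mode.\<close>
  define f where "f n x = (case x of (t, k) \<Rightarrow> Y (r1 n) t k / (B * 2 ^ k))" for n and x :: "real \<times> nat"
  have f: "norm (f n x) \<le> 1" if "x \<in> Q" for n x
    using that YB Y_nonneg B by (auto simp: Q_def f_def field_simps)
  have "\<exists>r2 :: nat \<Rightarrow> nat. strict_mono r2 \<and> (\<forall>x\<in>Q. \<exists>l. (\<lambda>n. f (r2 n) x) \<longlonglongrightarrow> l)"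
    by (rule function_convergent_subsequence[where f = f, OF Q f]) auto
  then obtain r2 where r2: "strict_mono (r2 :: nat \<Rightarrow> nat)" "\<And>x. x \<in> Q \<Longrightarrow> \<exists>l. (\<lambda>n. f (r2 n) x) \<longlonglongrightarrow> l"
    by blast
  define r where "r n = r1 (r2 n)" for n
  have "strict_mono r"
    using strict_mono_o[OF r1(1) r2(1)] by (simp add: r_def[abs_def] o_def)
  then have r: "n \<le> r n" for n by (rule seq_suble)
  have Sr: "(\<lambda>n. S (r n)) \<longlonglongrightarrow> T"
    using LIMSEQ_subseq_LIMSEQ[OF r1(2) r2(1)] by (simp add: r_def o_def)
  have conv: "convergent (\<lambda>n. Y (r n) t k)" if "t \<ge> 0" for t k
  proof (rule equilipschitz_convergent[where L = "L k"])
    fix p :: real assume "p \<in> \<rat>" "p \<ge> 0"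
    then obtain l where "(\<lambda>n. Y (r n) p k / (B * 2 ^ k)) \<longlonglongrightarrow> l"
      using r2(2)[of "(p, k)"] by (auto simp: Q_def r_def f_def)
    then have "(\<lambda>n. Y (r n) p k / (B * 2 ^ k) * (B * 2 ^ k)) \<longlonglongrightarrow> l * (B * 2 ^ k)"
      by (rule tendsto_mult_right)
    then show "convergent (\<lambda>n. Y (r n) p k)"
      using B by (auto simp: convergent_def)
  qed (use Ylip that in auto)
  define X where "X t k = lim (\<lambda>n. Y (r n) t k)" for t k
  have lim: "(\<lambda>n. Y (r n) t k) \<longlonglongrightarrow> X t k" if "t \<ge> 0" for t k
    using conv[OF that] by (simp add: X_def convergent_LIMSEQ_iff)
  have X_nonneg: "X t k \<ge> 0" if "t \<ge> 0" for t k
    by (rule LIMSEQ_le_const[OF lim[OF that]]) (use Y_nonneg[OF that] in auto)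
  have XB: "X t k \<le> B * 2 ^ k" if "t \<ge> 0" for t k
    by (rule LIMSEQ_le_const2[OF lim[OF that]]) (use YB[OF that] in auto)
  have X_0: "X t 0 = 0" if "t \<ge> 0" for t
    using lim[OF that, of 0] truncated_dyadic.X_0[OF Y that] by (simp add: LIMSEQ_const_iff)
  have X_init: "X 0 k = 0" for k
  proof -
    have "eventually (\<lambda>n. Y (r n) 0 k = 0) sequentially"
      using eventually_ge_at_top[of k]
    proof eventually_elim
      case (elim n)
      then show ?case using r[of n] by (intro Y0) simp
    qed
    then have "(\<lambda>n. Y (r n) 0 k) \<longlonglongrightarrow> 0" by (rule tendsto_eventually)
    then show ?thesis using lim[of 0 k] LIMSEQ_unique by auto
  qed
  have Xlip: "\<bar>X s k - X t k\<bar> \<le> L k * \<bar>s - t\<bar>" if "s \<ge> 0" "t \<ge> 0" for s t k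
  proof (rule LIMSEQ_le_const2)
    show "(\<lambda>n. \<bar>Y (r n) s k - Y (r n) t k\<bar>) \<longlonglongrightarrow> \<bar>X s k - X t k\<bar>"
      by (intro tendsto_intros lim that)
  qed (use Ylip that in auto)
  have Xcont: "continuous_on {0..} (\<lambda>t. X t k)" for k
  proof (rule lipschitz_on_continuous_on)
    have "0 \<le> L k" using Xlip[of 0 1 k] by auto
    then show "(L k)-lipschitz_on {0..} (\<lambda>t. X t k)"
      using Xlip by (intro lipschitz_onI) (auto simp: dist_real_def)
  qed
  have rhs_cont: "continuous_on {0..} (\<lambda>t. dyadic_rhs \<nu> q (X t) k)" for k
    unfolding dyadic_rhs_def by (intro continuous_intros Xcont)
  have rhs_lim: "(\<lambda>n. dyadic_rhs \<nu> q (Y (r n) t) k) \<longlonglongrightarrow> dyadic_rhs \<nu> q (X t) k" if "t \<ge> 0" for t k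
    unfolding dyadic_rhs_def by (intro tendsto_intros lim that)
  \<comment> \<open>The limit is taken in the integrated equation, where pointwise convergence and
    the majorant \<open>L k\<close> suffice; differentiability of \<open>X\<close> is recovered
    afterwards.\<close>
  have integral: "((\<lambda>s. dyadic_rhs \<nu> q (X s) k) has_integral X t k) {0..t}" if t: "t \<ge> 0" and k: "k \<ge> 1" for t k
  proof (rule has_integral_dominated_convergence[where h = "\<lambda>_. L k"])
    show "((\<lambda>s. dyadic_rhs \<nu> q (Y (r n) s) k) has_integral Y (r n) t k - Y (r n) 0 k) {0..t}" for n
      by (rule truncated_dyadic.has_integral_rhs[OF Y t k])
    show "(\<lambda>n. Y (r n) t k - Y (r n) 0 k) \<longlonglongrightarrow> X t k"
      using tendsto_diff[OF lim[OF t, of k] lim[of 0 k]] by (simp add: X_init)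
    show "\<forall>s\<in>{0..t}. norm (dyadic_rhs \<nu> q (Y (r n) s) k) \<le> L k" for n
      using truncated_dyadic.abs_rhs_le[OF Y YB] by (auto simp: L_def)
  qed (use rhs_lim in \<open>auto intro: integrable_const_ivl\<close>)
  have X_deriv: "((\<lambda>u. X u k) has_real_derivative dyadic_rhs \<nu> q (X t) k) (at t within {0..})"
    if t: "t \<ge> 0" and k: "k \<ge> 1" for t k
  proof -
    have "((\<lambda>u. integral {0..u} (\<lambda>s. dyadic_rhs \<nu> q (X s) k)) has_vector_derivative dyadic_rhs \<nu> q (X t) k)
        (at t within {0..})"
      by (rule integral_has_vector_derivative_half_line[OF rhs_cont t])
    then have "((\<lambda>u. X u k) has_vector_derivative dyadic_rhs \<nu> q (X t) k) (at t within {0..})"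
      by (rule has_vector_derivative_transform[rotated 2]) (use t integral_unique[OF integral[OF _ k]] in auto)
    then show ?thesis by (simp add: has_real_derivative_iff_has_vector_derivative)
  qed
  have X_smooth: "\<exists>C>0. \<forall>t\<ge>d. \<forall>k\<ge>1. (X t k)\<^sup>2 \<le> C * exp (- \<nu> * q ^ k * t)" if "d > 0" for d
  proof -
    obtain C where C: "C > 0" "\<And>n t k. t \<ge> d \<Longrightarrow> k \<ge> 1 \<Longrightarrow> (Y n t k)\<^sup>2 \<le> C * exp (- \<nu> * q ^ k * t)"
      using smooth[OF \<open>d > 0\<close>] by auto
    have "(X t k)\<^sup>2 \<le> C * exp (- \<nu> * q ^ k * t)" if "t \<ge> d" "k \<ge> 1" for t k
    proof (rule LIMSEQ_le_const2)
      show "(\<lambda>n. (Y (r n) t k)\<^sup>2) \<longlonglongrightarrow> (X t k)\<^sup>2"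
        using \<open>d > 0\<close> that by (intro tendsto_intros lim) auto
    qed (use C that in auto)
    then show ?thesis using C(1) by blast
  qed
  have X_T: "X T 1 = 1"
  proof -
    have T0: "T \<ge> 0" using T by simp
    have "(\<lambda>n. L 1 * \<bar>S (r n) - T\<bar>) \<longlonglongrightarrow> L 1 * \<bar>T - T\<bar>"
      by (intro tendsto_intros Sr)
    then have "(\<lambda>n. L 1 * \<bar>S (r n) - T\<bar>) \<longlonglongrightarrow> 0" by simp
    then have "(\<lambda>n. 1 - Y (r n) T 1) \<longlonglongrightarrow> 0"
    proof (rule Lim_null_comparison[rotated], intro always_eventually allI)
      show "norm (1 - Y (r n) T 1) \<le> L 1 * \<bar>S (r n) - T\<bar>" for n
        using Ylip[OF S(1) T0, of "r n" "r n" 1] S(2)[of "r n"] by simp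
    qed
    moreover have "(\<lambda>n. 1 - Y (r n) T 1) \<longlonglongrightarrow> 1 - X T 1"
      by (intro tendsto_intros lim T0)
    ultimately show ?thesis using LIMSEQ_unique by fastforce
  qed
  have X_low: "\<nu> * q / 2 * real K \<le> l2_norm (X t) ^ 3"
    if t: "t > 0" and K: "K \<ge> 1" and small: "8 * B\<^sup>2 * t * (8 * q) ^ K \<le> 1" for t K
  proof -
    obtain C where C: "C > 0" "\<And>n s k. s \<ge> t \<Longrightarrow> k \<ge> 1 \<Longrightarrow> (Y n s k)\<^sup>2 \<le> C * exp (- \<nu> * q ^ k * s)"
      using smooth[OF t] by auto
    \<comment> \<open>At fixed \<open>t > 0\<close> the smoothing bound is a summable majorant, so
      no energy escapes to high modes and the norms converge.\<close>
    have "(\<lambda>n. \<Sum>k. (Y (r n) t (Suc k))\<^sup>2) \<longlonglongrightarrow> (\<Sum>k. (X t (Suc k))\<^sup>2)"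
    proof (rule conjunct2[OF conjunct2[OF tannerys_theorem]])
      show "(\<lambda>n. (Y (r n) t (Suc k))\<^sup>2) \<longlonglongrightarrow> (X t (Suc k))\<^sup>2" for k
        using t by (intro tendsto_intros lim) auto
      show "\<forall>\<^sub>F (k, n) in at_top \<times>\<^sub>F sequentially. norm ((Y (r n) t (Suc k))\<^sup>2) \<le> C * exp (- (\<nu> * t) * q ^ Suc k)"
      proof -
        have "norm ((Y (r n) t (Suc k))\<^sup>2) \<le> C * exp (- (\<nu> * t) * q ^ Suc k)" for n k
          using C(2)[of t "Suc k" "r n"] by (simp add: mult_ac del: power_Suc)
        then show ?thesis by (intro always_eventually) auto
      qed
      show "summable (\<lambda>k. C * exp (- (\<nu> * t) * q ^ Suc k))"
        using summable_powr_exp[of q "\<nu> * t" 1 0] q nu t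
        by (intro summable_mult) (simp del: power_Suc)
    qed auto
    then have "(\<lambda>n. sqrt (\<Sum>k. (Y (r n) t (Suc k))\<^sup>2) ^ 3) \<longlonglongrightarrow> l2_norm (X t) ^ 3"
      unfolding l2_norm_def by (intro tendsto_intros)
    moreover have "\<exists>N. \<forall>n\<ge>N. \<nu> * q / 2 * real K \<le> sqrt (\<Sum>k. (Y (r n) t (Suc k))\<^sup>2) ^ 3"
    proof (intro exI allI impI)
      fix n assume n: "n \<ge> K"
      interpret truncated_dyadic \<nu> q "Suc (r n)" "Y (r n)" by (rule Y)
      have "\<nu> * q / 2 * real K \<le> sqrt (energy 1 t) ^ 3"
        using YB Y0 S t K small n r[of n] by (intro energy_lower_bound[where T = "S (r n)"]) auto
      then show "\<nu> * q / 2 * real K \<le> sqrt (\<Sum>k. (Y (r n) t (Suc k))\<^sup>2) ^ 3"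
        by (simp only: energy_eq_suminf[OF less_imp_le[OF t]])
    qed
    ultimately show ?thesis by (rule LIMSEQ_le_const)
  qed
  show ?thesis
    by (rule that[OF X_nonneg X_0 X_init X_deriv XB[unfolded B_def] X_smooth _ X_T X_low[unfolded B_def]])
       (use T in auto)
qed

section \<open>Norm continuity, the logarithmic rate and the final assembly\<close>

text \<open>By dominated convergence for series, a summable majorant near each time upgrades
  continuity of the modes to continuity in norm.\<close>

lemma Hs_continuous_onI:
  assumes cont: "\<And>k. k \<ge> 1 \<Longrightarrow> continuous_on I (\<lambda>t. X t k)"
    and dom: "\<And>t. t \<in> I \<Longrightarrow> \<exists>J g. open J \<and> t \<in> J \<and> summable g \<and>
      (\<forall>u\<in>I \<inter> J. \<forall>k. freq lam (Suc k) powr (2 * s) * (X u (Suc k))\<^sup>2 \<le> g k)"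
  shows "Hs_continuous_on lam s I X"
  unfolding Hs_continuous_on_def
proof safe
  fix t assume t: "t \<in> I"
  then obtain J g where J: "open J" "t \<in> J" and g: "summable g"
    and le: "\<And>u k. u \<in> I \<Longrightarrow> u \<in> J \<Longrightarrow> freq lam (Suc k) powr (2 * s) * (X u (Suc k))\<^sup>2 \<le> g k"
    using dom[OF t] by blast
  show "X t \<in> Hs_space lam s"
    unfolding Hs_space_def mem_Collect_eq
    by (rule summable_comparison_test'[OF g, of 0]) (use le t J in auto)
  let ?a = "\<lambda>k u. freq lam (Suc k) powr (2 * s) * (X u (Suc k) - X t (Suc k))\<^sup>2"
  show "((\<lambda>u. Hs_norm lam s (\<lambda>k. X u k - X t k)) \<longlongrightarrow> 0) (at t within I)"
  proof (cases "at t within I = bot")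
    case False
    have near: "\<forall>\<^sub>F u in at t within I. \<forall>k. norm (?a k u) \<le> 4 * g k"
      unfolding eventually_at_topological
    proof (intro exI[of _ J] conjI J ballI impI allI)
      fix u k assume u: "u \<in> J" "u \<in> I"
      have "(X u (Suc k) - X t (Suc k))\<^sup>2 \<le> 2 * (X u (Suc k))\<^sup>2 + 2 * (X t (Suc k))\<^sup>2"
        using zero_le_power2[of "X u (Suc k) + X t (Suc k)"] by (simp add: power2_eq_square algebra_simps)
      then have "?a k u \<le> freq lam (Suc k) powr (2 * s) * (2 * (X u (Suc k))\<^sup>2 + 2 * (X t (Suc k))\<^sup>2)"
        by (intro mult_left_mono) auto
      also have "\<dots> \<le> 4 * g k"
        using le[OF u(2,1), of k] le[OF t J(2), of k] by (simp add: algebra_simps)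
      finally show "norm (?a k u) \<le> 4 * g k" by simp
    qed
    have "((\<lambda>u. \<Sum>k. ?a k u) \<longlongrightarrow> (\<Sum>k. 0)) (at t within I)"
    proof (rule conjunct2[OF conjunct2[OF tannerys_theorem]])
      show "((\<lambda>u. ?a k u) \<longlongrightarrow> 0) (at t within I)" for k
      proof -
        have "((\<lambda>u. X u (Suc k)) \<longlongrightarrow> X t (Suc k)) (at t within I)"
          using cont[of "Suc k"] t by (simp add: continuous_on_def)
        then have "((\<lambda>u. ?a k u) \<longlongrightarrow> freq lam (Suc k) powr (2 * s) * (X t (Suc k) - X t (Suc k))\<^sup>2) (at t within I)"
          by (intro tendsto_intros)
        then show ?thesis by simp
      qed
      show "\<forall>\<^sub>F (k, u) in at_top \<times>\<^sub>F (at t within I). norm (?a k u) \<le> 4 * g k"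
        by (rule eventually_mono[OF eventually_prodI[OF eventually_True near]]) auto
      show "summable (\<lambda>k. 4 * g k)" by (intro summable_mult g)
    qed (rule False)
    then have "((\<lambda>u. sqrt (\<Sum>k. ?a k u)) \<longlongrightarrow> sqrt (\<Sum>k. 0)) (at t within I)"
      by (rule tendsto_real_sqrt)
    then show ?thesis by (simp add: Hs_norm_def)
  qed simp
qed

text \<open>For given \<open>t\<close> the largest admissible \<open>K\<close> is about
  \<open>ln (1 / (b * t)) / ln Q\<close>.\<close>

lemma logarithmic_lower_bound:
  fixes F :: "real \<Rightarrow> real"
  assumes a: "a > 0" and b: "b > 0" and Q: "Q \<ge> 8"
    and F0: "\<And>t. F t \<ge> 0"
    and F: "\<And>t K. t > 0 \<Longrightarrow> K \<ge> 1 \<Longrightarrow> b * t * Q ^ K \<le> 1 \<Longrightarrow> a * real K \<le> F t ^ 3"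
  obtains c t0 where "c > 0" "t0 > 0"
    "\<And>t. 0 < t \<Longrightarrow> t < t0 \<Longrightarrow> c * (1 + ln (t0 / t)) powr (1/3) \<le> F t"
proof -
  define l where "l = ln Q"
  have el: "exp l = Q" using Q by (simp add: l_def)
  have l: "l \<ge> 1"
    using Q exp_le ln_ge_iff[of Q 1] by (simp add: l_def)
  \<comment> \<open>This keeps two units of \<open>l = ln Q\<close> in reserve: one pays for
    rounding down to \<open>K\<close>, the other, as \<open>l \<ge> 1\<close>, for the 1 next to the
    logarithm.\<close>
  define t0 where "t0 = exp (- 2 * l) / b"
  have t0: "t0 > 0" using b by (simp add: t0_def)
  define c where "c = (a / l) powr (1/3)"
  have c: "c > 0" using a l by (simp add: c_def)
  show ?thesis
  proof (rule that[OF c t0])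
    fix t assume t: "0 < t" "t < t0"
    define u where "u = ln (t0 / t)"
    have u: "u > 0" using t by (simp add: u_def)
    have tu: "b * t = exp (- (2 * l + u))"
    proof -
      have "exp u = t0 / t" using t t0 by (simp add: u_def)
      then have "b * t * exp u = exp (- 2 * l)" using t b by (simp add: t0_def field_simps)
      then have "b * t * exp u * exp (- u) = exp (- 2 * l) * exp (- u)" by simp
      then show ?thesis by (simp add: mult.assoc flip: exp_add)
    qed
    define K where "K = nat \<lfloor>(2 * l + u) / l\<rfloor>"
    have nn: "(2 * l + u) / l \<ge> 2" using l u by (simp add: field_simps)
    have K: "real K \<le> (2 * l + u) / l" "(2 * l + u) / l - 1 < real K"
      using nn unfolding K_def by linarith+
    have "K \<ge> 1" using K nn by linarith
    have "Q ^ K = exp (real K * l)" by (simp add: exp_of_nat_mult el)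
    also have "\<dots> \<le> exp (2 * l + u)" using K(1) l by (simp add: field_simps)
    finally have "b * t * Q ^ K \<le> exp (- (2 * l + u)) * exp (2 * l + u)"
      unfolding tu by (intro mult_left_mono) auto
    then have "b * t * Q ^ K \<le> 1" by (simp flip: exp_add)
    then have Ft: "a * real K \<le> F t ^ 3" by (rule F[OF t(1) \<open>K \<ge> 1\<close>])
    have "(1 + u) / l \<le> (2 * l + u) / l - 1" using l by (simp add: field_simps)
    then have "a * ((1 + u) / l) \<le> a * real K" using K(2) a by (intro mult_left_mono) auto
    then have "(a / l) * (1 + u) \<le> F t ^ 3" using Ft by simp
    then have "((a / l) * (1 + u)) powr (1/3) \<le> (F t ^ 3) powr (1/3)"
      using a l u by (intro powr_mono2) auto
    also have "(F t ^ 3) powr (1/3) = F t"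
      using F0[of t] by (cases "F t = 0") (auto simp: powr_powr simp flip: powr_numeral)
    also have "((a / l) * (1 + u)) powr (1/3) = c * (1 + u) powr (1/3)"
      unfolding c_def by (rule powr_mult)
    finally show "c * (1 + ln (t0 / t)) powr (1/3) \<le> F t" by (simp add: u_def)
  qed
qed

theorem theorem1p3:
  fixes \<nu> \<alpha> lam \<sigma> :: real
  assumes "\<nu> > 0" and "\<alpha> = 2" and "lam > 1" and "\<sigma> > 0" and "lam powr \<sigma> \<ge> 2"
  shows "\<exists>X :: real \<Rightarrow> nat \<Rightarrow> real.
           dyadic_solution \<nu> \<alpha> lam X \<and>
           (\<forall>t\<ge>0. \<forall>k\<ge>1. X t k \<ge> 0) \<and>
           (\<exists>t\<ge>0. \<exists>k\<ge>1. X t k \<noteq> 0) \<and>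
           (\<forall>s < - \<sigma>. Hs_continuous_on lam s {0..} X) \<and>
           (\<forall>r. Hs_continuous_on lam r {0<..} X) \<and>
           (\<forall>k\<ge>1. X 0 k = 0) \<and>
           filterlim (\<lambda>t. l2_norm (X t)) at_top (at_right 0) \<and>
           (\<exists>c t0. c > 0 \<and> t0 > 0 \<and>
              (\<forall>t. 0 < t \<and> t < t0 \<longrightarrow>
                 l2_norm (X t) \<ge> c * (1 + ln (t0 / t)) powr (1/3)))"
proof -
  define q where "q = lam\<^sup>2"
  have q: "q > 1" using assms(3) by (simp add: q_def)
  define B where "B = 1 + \<nu> * q"
  have B: "B \<ge> 1" using q assms(1) by (simp add: B_def)
  show ?thesis
  proof (rule cascade_from_infinity[OF assms(1) q, folded B_def])
    fix X :: "real \<Rightarrow> nat \<Rightarrow> real" and T :: real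
    assume nonneg: "\<And>t k. t \<ge> 0 \<Longrightarrow> 0 \<le> X t k" and X_0: "\<And>t. t \<ge> 0 \<Longrightarrow> X t 0 = 0"
    and init: "\<And>k. X 0 k = 0"
    and deriv: "\<And>t k. t \<ge> 0 \<Longrightarrow> k \<ge> 1 \<Longrightarrow>
      ((\<lambda>u. X u k) has_real_derivative dyadic_rhs \<nu> q (X t) k) (at t within {0..})"
    and XB: "\<And>t k. t \<ge> 0 \<Longrightarrow> X t k \<le> B * 2 ^ k"
    and smooth: "\<And>d. d > 0 \<Longrightarrow> \<exists>C>0. \<forall>t\<ge>d. \<forall>k\<ge>1. (X t k)\<^sup>2 \<le> C * exp (- \<nu> * q ^ k * t)"
    and T: "T \<ge> 0" "X T 1 = 1"
    and low: "\<And>t K. t > 0 \<Longrightarrow> K \<ge> 1 \<Longrightarrow> 8 * B\<^sup>2 * t * (8 * q) ^ K \<le> 1 \<Longrightarrow>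
      \<nu> * q / 2 * real K \<le> l2_norm (X t) ^ 3"
    have freq_pos: "freq lam k > 0" for k using assms(3) by (simp add: freq_def)
    have powr_power_freq: "(lam powr x) ^ k = freq lam k powr x" for x k
      using assms(3) by (induction k) (simp_all add: freq_def powr_mult)
    have freq2: "(freq lam k)\<^sup>2 = q ^ k" for k
      by (simp add: freq_def q_def mult.commute flip: power_mult)
    have freq_powr: "freq lam k powr \<alpha> = q ^ k" for k
      using freq_pos[of k] by (simp add: assms(2) freq2)
    have cont: "continuous_on {0..} (\<lambda>t. X t k)" if "k \<ge> 1" for k
      unfolding continuous_on_eq_continuous_within using DERIV_continuous[OF deriv[OF _ that]] by simp
    have sol: "dyadic_solution \<nu> \<alpha> lam X"
      unfolding dyadic_solution_def freq_powr freq2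
      using X_0 cont deriv unfolding dyadic_rhs_def by blast
    have C1: "Hs_continuous_on lam s {0..} X" if s: "s < - \<sigma>" for s
    proof (rule Hs_continuous_onI[OF cont])
      fix t :: real assume "t \<in> {0..}"
      \<comment> \<open>Since \<open>2 ^ k\<close> is at most the frequency to the power
        \<open>\<sigma>\<close>, the weighted squares are dominated by a geometric series with ratio
        below 1, uniformly down to time 0.\<close>
      define g where "g k = B\<^sup>2 * (lam powr (2 * (s + \<sigma>))) ^ Suc k" for k
      have "lam powr (2 * (s + \<sigma>)) < 1"
        using assms(3) s by (simp add: powr_less_one)
      then have "summable g"
        unfolding g_def by (intro summable_mult, subst summable_Suc_iff) (simp add: summable_geometric)
      moreover have "freq lam (Suc k) powr (2 * s) * (X u (Suc k))\<^sup>2 \<le> g k" if "u \<in> {0..}" for u k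
      proof -
        have "X u (Suc k) \<le> B * 2 ^ Suc k" using XB[of u "Suc k"] that by simp
        also have "\<dots> \<le> B * (lam powr \<sigma>) ^ Suc k"
          using assms(5) B by (intro mult_left_mono power_mono) auto
        also have "(lam powr \<sigma>) ^ Suc k = freq lam (Suc k) powr \<sigma>"
          by (simp only: powr_power_freq)
        finally have "(X u (Suc k))\<^sup>2 \<le> (B * freq lam (Suc k) powr \<sigma>)\<^sup>2"
          using nonneg that by (intro power_mono) auto
        then have "freq lam (Suc k) powr (2 * s) * (X u (Suc k))\<^sup>2
            \<le> freq lam (Suc k) powr (2 * s) * (B * freq lam (Suc k) powr \<sigma>)\<^sup>2"
          by (intro mult_left_mono) auto
        also have "\<dots> = B\<^sup>2 * freq lam (Suc k) powr (2 * (s + \<sigma>))"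
        proof -
          have "2 * (s + \<sigma>) = 2 * s + (\<sigma> + \<sigma>)" by simp
          then have "freq lam (Suc k) powr (2 * (s + \<sigma>)) =
              freq lam (Suc k) powr (2 * s) * (freq lam (Suc k) powr \<sigma>)\<^sup>2"
            by (simp only: powr_add power2_eq_square)
          then show ?thesis by (simp only: power_mult_distrib mult.left_commute)
        qed
        also have "freq lam (Suc k) powr (2 * (s + \<sigma>)) = (lam powr (2 * (s + \<sigma>))) ^ Suc k"
          by (simp only: powr_power_freq)
        finally show ?thesis by (simp add: g_def)
      qed
      ultimately show "\<exists>J g. open J \<and> t \<in> J \<and> summable g \<and>
        (\<forall>u\<in>{0..} \<inter> J. \<forall>k. freq lam (Suc k) powr (2 * s) * (X u (Suc k))\<^sup>2 \<le> g k)"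
        by (intro exI[of _ UNIV] exI[of _ g]) auto
    qed
    have C2: "Hs_continuous_on lam r {0<..} X" for r
    proof (rule Hs_continuous_onI)
      show "continuous_on {0<..} (\<lambda>t. X t k)" if "k \<ge> 1" for k
        using cont[OF that] by (rule continuous_on_subset) auto
      fix t :: real assume "t \<in> {0<..}"
      then have t: "t > 0" by simp
      then obtain C where C: "C > 0" "\<And>u k. u \<ge> t / 2 \<Longrightarrow> k \<ge> 1 \<Longrightarrow> (X u k)\<^sup>2 \<le> C * exp (- \<nu> * q ^ k * u)"
        using smooth[of "t / 2"] by auto
      \<comment> \<open>For \<open>u > t / 2\<close>, the smoothing bound with
        \<open>d = t / 2\<close> beats every power of the frequency.\<close>
      define g where "g k = C * ((lam ^ Suc k) powr (2 * r) * exp (- (\<nu> * t / 2) * (lam ^ Suc k)\<^sup>2))" for k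
      have "summable g"
        unfolding g_def using assms(1,3) t by (intro summable_mult summable_powr_exp) auto
      moreover have "freq lam (Suc k) powr (2 * r) * (X u (Suc k))\<^sup>2 \<le> g k" if u: "u > t / 2" for u k
      proof -
        have "(X u (Suc k))\<^sup>2 \<le> C * exp (- \<nu> * q ^ Suc k * u)" by (rule C(2)) (use u in auto)
        also have "\<dots> \<le> C * exp (- \<nu> * q ^ Suc k * (t / 2))"
        proof -
          have "\<nu> * q ^ Suc k * (t / 2) \<le> \<nu> * q ^ Suc k * u"
            using u q assms(1) by (intro mult_left_mono) auto
          then show ?thesis using C(1) by simp
        qed
        also have "\<dots> = C * exp (- (\<nu> * t / 2) * (lam ^ Suc k)\<^sup>2)"
          using freq2[of "Suc k"] by (simp add: freq_def mult_ac del: power_Suc)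
        finally have "(lam ^ Suc k) powr (2 * r) * (X u (Suc k))\<^sup>2
            \<le> (lam ^ Suc k) powr (2 * r) * (C * exp (- (\<nu> * t / 2) * (lam ^ Suc k)\<^sup>2))"
          by (intro mult_left_mono) auto
        then show ?thesis by (simp add: g_def freq_def mult_ac del: power_Suc)
      qed
      ultimately show "\<exists>J g. open J \<and> t \<in> J \<and> summable g \<and>
        (\<forall>u\<in>{0<..} \<inter> J. \<forall>k. freq lam (Suc k) powr (2 * r) * (X u (Suc k))\<^sup>2 \<le> g k)"
        using t by (intro exI[of _ "{t / 2<..}"] exI[of _ g]) auto
    qed
    have l2_nonneg: "l2_norm (X t) \<ge> 0" if "t > 0" for t
    proof -
      have "X t \<in> Hs_space lam 0" using C2[of 0] that by (auto simp: Hs_continuous_on_def)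
      then show ?thesis
        using assms(3) by (auto simp: Hs_space_0 l2_norm_def intro: suminf_nonneg)
    qed
    \<comment> \<open>\<open>max 0\<close> makes the function nonnegative at all times, as the lemma
      demands; for \<open>t > 0\<close> it is the norm itself.\<close>
    obtain c t0 where c: "c > 0" "t0 > 0"
      and bound: "\<And>t. 0 < t \<Longrightarrow> t < t0 \<Longrightarrow> c * (1 + ln (t0 / t)) powr (1/3) \<le> max 0 (l2_norm (X t))"
    proof (rule logarithmic_lower_bound[where F = "\<lambda>t. max 0 (l2_norm (X t))" and a = "\<nu> * q / 2"
          and b = "8 * B\<^sup>2" and Q = "8 * q"])
      show "\<nu> * q / 2 * real K \<le> (max 0 (l2_norm (X t))) ^ 3" if "t > 0" "K \<ge> 1" "8 * B\<^sup>2 * t * (8 * q) ^ K \<le> 1" for t K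
        using low[OF that] l2_nonneg[OF that(1)] by simp
    qed (use assms(1) q B in auto)
    have bound': "c * (1 + ln (t0 / t)) powr (1/3) \<le> l2_norm (X t)" if "0 < t" "t < t0" for t
      using bound[OF that] l2_nonneg[OF that(1)] by simp
    have "filterlim (\<lambda>t. c * (1 + ln (t0 / t)) powr (1/3)) at_top (at_right 0)"
      using c by real_asymp
    moreover have "\<forall>\<^sub>F t in at_right 0. c * (1 + ln (t0 / t)) powr (1/3) \<le> l2_norm (X t)"
      using eventually_at_right_less[of 0] eventually_at_right[of 0 1] bound' c(2)
      by (auto simp: eventually_at_right_field intro!: exI[of _ t0])
    ultimately have blowup: "filterlim (\<lambda>t. l2_norm (X t)) at_top (at_right 0)"
      by (rule filterlim_at_top_mono)
    show ?thesis
    proof (intro exI[of _ X] conjI sol blowup)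
      show "\<exists>t\<ge>0. \<exists>k\<ge>1. X t k \<noteq> 0" using T by (intro exI[of _ T] conjI exI[of _ 1]) auto
      show "\<exists>c t0. c > 0 \<and> t0 > 0 \<and> (\<forall>t. 0 < t \<and> t < t0 \<longrightarrow> l2_norm (X t) \<ge> c * (1 + ln (t0 / t)) powr (1/3))"
        using c bound' by blast
    qed (use nonneg C1 C2 init in auto)
  qed
qed

end
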